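(* Let $G=(V,E)$ be a finite simple graph with maximum degree $\Delta\ge 3$ and finite girth $g\ge 3$, and let $P_G$ be its chromatic polynomial. Then, with the explicitly computable constant $C(\Delta,g)$ defined in the context, $P_G(q)\neq 0$ for every $q\in\mathbb{C}$ satisfying $$|q|\ge C(\Delta,g).$$
   Context: The girth of a graph is the length of its shortest cycle. The chromatic polynomial $P_G$ is the polynomial whose value at every positive integer $q$ is the number of proper colorings of $V$ with $q$ colors; it is evaluated at complex $q$. Definition of $C(\Delta,g)$, for integers $\Delta\ge 3$ and $g\ge 3$. Let $$\rho_\Delta=\left(\frac{\Delta-1}{\Delta-2}\right)^{\Delta}.$$ For $b\in[1,\rho_\Delta)$ and $d\in\mathbb{N}$ put $$x_\Delta(b)=\frac{b^{2/\Delta}-b^{1/\Delta}}{b},\qquad f^d_\Delta(b)=\frac{1}{\Delta-1}\cdot\frac{\big[(\Delta-1)(1-b^{-1/\Delta})\big]^{d}}{1-(\Delta-1)(1-b^{-1/\Delta})}.$$ For $a\in[0,1]$ and $b\in[1,\rho_\Delta)$ put $$K^g_\Delta(a,b)=\big[1+(1-a)x_\Delta(b)\big]^{\Delta}-1+f^{g-2}_\Delta(b)\binom{\Delta}{2}\,b\,x_\Delta(b)\,\big(1+b\,x_\Delta(b)\big)^{\Delta-1},$$ $$b^g_\Delta(a)=\sup\{b\in[1,\rho_\Delta):\ K^g_\Delta(a,b)\le a\},\qquad z^g_\Delta(a)=(1-a)\,x_\Delta\big(b^g_\Delta(a)\big).$$ Finally $$C(\Delta,g)=\Big[\max_{a\in[0,1]}z^g_\Delta(a)\Big]^{-1}.$$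 *)

theory Defs
  imports
    Complex_Main
    "HOL-Library.FuncSet"
    "HOL-Library.Extended_Nat"
    "HOL-Computational_Algebra.Polynomial"
begin

subsection \<open>Finite simple graphs\<close>

definition finite_simple_graph :: "'a set \<Rightarrow> 'a set set \<Rightarrow> bool" where
  "finite_simple_graph V E \<longleftrightarrow> finite V \<and> (\<forall>e\<in>E. e \<subseteq> V \<and> card e = 2)"

definition degree_in :: "'a set set \<Rightarrow> 'a \<Rightarrow> nat" where
  "degree_in E v = card {e \<in> E. v \<in> e}"

definition max_degree :: "'a set \<Rightarrow> 'a set set \<Rightarrow> nat" where
  "max_degree V E = Max (degree_in E ` V)"

text \<open>A cycle is the list of its vertices, the first vertex not being repeated at the end; its
  length is thus the length of the list.\<close>

definition is_cycle :: "'a set set \<Rightarrow> 'a list \<Rightarrow> bool" where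
  "is_cycle E c \<longleftrightarrow> 3 \<le> length c \<and> distinct c \<and>
     (\<forall>i < length c. {c ! i, c ! (Suc i mod length c)} \<in> E)"

text \<open>The girth of a forest is \<open>\<infinity>\<close>, the infimum of the empty set in \<^typ>\<open>enat\<close>.\<close>

definition girth :: "'a set set \<Rightarrow> enat" where
  "girth E = (INF c \<in> {c. is_cycle E c}. enat (length c))"

subsection \<open>The chromatic polynomial\<close>

definition proper_colorings :: "'a set \<Rightarrow> 'a set set \<Rightarrow> nat \<Rightarrow> ('a \<Rightarrow> nat) set" where
  "proper_colorings V E q =
     {f \<in> V \<rightarrow>\<^sub>E {1..q}. \<forall>u v. {u, v} \<in> E \<longrightarrow> f u \<noteq> f v}"

definition chromatic_poly :: "'a set \<Rightarrow> 'a set set \<Rightarrow> complex poly" where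
  "chromatic_poly V E =
     (THE p. \<forall>q::nat. 1 \<le> q \<longrightarrow> poly p (of_nat q) = of_nat (card (proper_colorings V E q)))"

subsection \<open>The constant\<close>

definition rho :: "nat \<Rightarrow> real" where
  "rho \<Delta> = ((real \<Delta> - 1) / (real \<Delta> - 2)) ^ \<Delta>"

definition x_fun :: "nat \<Rightarrow> real \<Rightarrow> real" where
  "x_fun \<Delta> b = (b powr (2 / real \<Delta>) - b powr (1 / real \<Delta>)) / b"

definition f_fun :: "nat \<Rightarrow> nat \<Rightarrow> real \<Rightarrow> real" where
  "f_fun \<Delta> d b = 1 / (real \<Delta> - 1) *
     (((real \<Delta> - 1) * (1 - b powr (- 1 / real \<Delta>))) ^ d /
      (1 - (real \<Delta> - 1) * (1 - b powr (- 1 / real \<Delta>))))"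

definition K_fun :: "nat \<Rightarrow> nat \<Rightarrow> real \<Rightarrow> real \<Rightarrow> real" where
  "K_fun \<Delta> g a b = (1 + (1 - a) * x_fun \<Delta> b) ^ \<Delta> - 1 +
     f_fun \<Delta> (g - 2) b * real (\<Delta> choose 2) * b * x_fun \<Delta> b * (1 + b * x_fun \<Delta> b) ^ (\<Delta> - 1)"

definition b_fun :: "nat \<Rightarrow> nat \<Rightarrow> real \<Rightarrow> real" where
  "b_fun \<Delta> g a = Sup {b \<in> {1..<rho \<Delta>}. K_fun \<Delta> g a b \<le> a}"

definition z_fun :: "nat \<Rightarrow> nat \<Rightarrow> real \<Rightarrow> real" where
  "z_fun \<Delta> g a = (1 - a) * x_fun \<Delta> (b_fun \<Delta> g a)"

text \<open>The maximum is attained: \<^term>\<open>K_fun \<Delta> g a b\<close> tends to \<open>\<infinity>\<close> as \<open>b\<close> tends to \<^term>\<open>rho \<Delta>\<close>,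
  uniformly in \<open>a\<close>, so the pairs \<open>(a, b)\<close> with \<^term>\<open>K_fun \<Delta> g a b \<le> a\<close> form a compact set, and
  \<^term>\<open>x_fun \<Delta>\<close> is increasing and continuous on \<^term>\<open>{1..<rho \<Delta>}\<close>.\<close>

definition C_const :: "nat \<Rightarrow> nat \<Rightarrow> real" where
  "C_const \<Delta> g = inverse (GREATEST z. z \<in> z_fun \<Delta> g ` {0..1})"

end

theory Submission
  imports Defs "HOL-Library.Disjoint_Sets" "HOL-Analysis.Elementary_Normed_Spaces"
begin

text \<open>
  Let \<open>w\<close> be the logarithm, with respect to disjoint union, of the indicator of independent sets. Then
  \<open>P\<^sub>G(q)\<close> is the sum over partitions of \<open>V\<close> of the products of \<open>q w(B)\<close> over the blocks. Up to sign
  \<open>w(B)\<close> is the number \<open>t(B)\<close> of spanning trees of \<open>B\<close> without broken circuits, and \<open>t\<close> satisfies a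
  recursion: removing a vertex \<open>u\<close> from \<open>B\<close> leaves a partition into blocks that each contain a neighbour
  of \<open>u\<close>. All estimates use this recursion only, so neither trees nor broken circuits appear.

  With \<open>z = -1/q\<close> and \<open>Z\<close> the partition sum of \<open>t(B) z\<^bsup>|B|-1\<^esup>\<close>, so that \<open>P\<^sub>G(q) = q\<^bsup>|V|\<^esup> Z(V)\<close>, one
  shows \<open>|Z(Y \<union> {u}) - Z(Y)| \<le> a |Z(Y)|\<close> by induction. Passing from \<open>Z(Y)\<close> to \<open>Z(Y \<union> {u})\<close> weights each
  block that meets the neighbourhood of \<open>u\<close> by \<open>1 + z\<close>. If no block contained two neighbours this would
  be a factor \<open>(1 + z)\<^bsup>deg u\<^esup>\<close>, which gives the first term of \<open>K\<close>; a block with two neighbours of \<open>u\<close>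
  contains a path of length at least \<open>g - 2\<close> between them, which gives the second.
\<close>

subsection \<open>Partition sums\<close>

text \<open>The exponential of \<open>f\<close> in the algebra of set functions whose product is
  convolution over disjoint unions.\<close>

definition pexp :: "('a set \<Rightarrow> 'b::comm_semiring_1) \<Rightarrow> 'a set \<Rightarrow> 'b" where
  "pexp f X = (\<Sum>\<pi> | partition_on X \<pi>. \<Prod>B\<in>\<pi>. f B)"

lemma pexp_empty [simp]: "pexp f {} = 1"
  by (simp add: pexp_def partition_on_empty)

lemma pexp_cong:
  assumes "\<And>B. B \<subseteq> X \<Longrightarrow> B \<noteq> {} \<Longrightarrow> f B = g B"
  shows "pexp f X = pexp g X"
  unfolding pexp_def
  by (intro sum.cong prod.cong refl assms) (auto simp: partition_on_def)

lemma partition_on_insert_block: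
  assumes "B \<subseteq> X" "B \<noteq> {}" "partition_on (X - B) \<pi>"
  shows "partition_on X (insert B \<pi>)"
  using assms by (auto simp: partition_on_def disjoint_def)

lemma partition_on_remove_block:
  assumes "partition_on X \<pi>" "B \<in> \<pi>"
  shows "partition_on (X - B) (\<pi> - {B})"
  using assms by (fastforce simp: partition_on_def disjoint_def)

lemma partition_on_unique_block:
  assumes "partition_on X \<pi>" "v \<in> X"
  shows "\<exists>!B. B \<in> \<pi> \<and> v \<in> B"
  using assms unfolding partition_on_def disjoint_def by blast

text \<open>A partition amounts to the block \<open>B\<close> of \<open>v\<close> together with a
  partition of \<open>X - B\<close>.\<close>

lemma pexp_rec:
  assumes "finite X" "v \<in> X"
  shows "pexp f X = (\<Sum>B | B \<subseteq> X \<and> v \<in> B. f B * pexp f (X - B))"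
proof -
  let ?S = "SIGMA B:{B. B \<subseteq> X \<and> v \<in> B}. {\<pi>. partition_on (X - B) \<pi>}"
  have fin: "finite {B. B \<subseteq> X \<and> v \<in> B}"
    by (rule finite_subset[of _ "Pow X"]) (use assms in auto)
  have notin: "B \<notin> \<pi>" if "partition_on (X - B) \<pi>" "v \<in> B" for B \<pi>
    using that by (auto simp: partition_on_def)
  have "pexp f X = (\<Sum>(B, \<pi>)\<in>?S. f B * (\<Prod>B\<in>\<pi>. f B))"
    unfolding pexp_def
  proof (rule sum.reindex_bij_witness[where i = "\<lambda>(B, \<pi>). insert B \<pi>"
        and j = "\<lambda>\<pi>. (THE B. B \<in> \<pi> \<and> v \<in> B, \<pi> - {THE B. B \<in> \<pi> \<and> v \<in> B})"], goal_cases)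
    case (1 \<pi>)
    then have "\<exists>!B. B \<in> \<pi> \<and> v \<in> B"
      using assms(2) by (intro partition_on_unique_block[of X]) auto
    from theI'[OF this] show ?case by auto
  next
    case (2 \<pi>)
    then have "\<exists>!B. B \<in> \<pi> \<and> v \<in> B"
      using assms(2) by (intro partition_on_unique_block[of X]) auto
    from theI'[OF this] 2 show ?case
      by (auto intro: partition_on_remove_block dest: partition_onD1)
  next
    case (3 p)
    obtain B \<pi> where p: "p = (B, \<pi>)" "B \<subseteq> X" "v \<in> B" "partition_on (X - B) \<pi>"
      using 3 by auto
    have "(THE B'. B' \<in> insert B \<pi> \<and> v \<in> B') = B"
      using p by (intro the_equality) (auto simp: partition_on_def)
    then show ?case using p notin by auto
  next
    case (4 p)
    then show ?case by (auto intro!: partition_on_insert_block)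
  next
    case (5 \<pi>)
    then have "\<exists>!B. B \<in> \<pi> \<and> v \<in> B"
      using assms(2) by (intro partition_on_unique_block[of X]) auto
    from theI'[OF this] show ?case
      using finite_elements[OF assms(1), of \<pi>] 5 by (auto simp: prod.remove)
  qed
  also have "\<dots> = (\<Sum>B | B \<subseteq> X \<and> v \<in> B. f B * pexp f (X - B))"
    using fin assms
    by (subst sum.Sigma[symmetric]) (auto simp: finitely_many_partition_on pexp_def sum_distrib_left)
  finally show ?thesis .
qed

lemma sum_blocks_insert:
  assumes "v \<notin> X"
  shows "(\<Sum>B | B \<subseteq> insert v X \<and> v \<in> B. h B) = (\<Sum>Y\<in>Pow X. h (insert v Y))"
  by (rule sum.reindex_bij_witness[where i = "insert v" and j = "\<lambda>B. B - {v}"])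
    (use assms in \<open>auto simp: insert_absorb\<close>)

lemma pexp_insert:
  assumes "finite X" "v \<notin> X"
  shows "pexp f (insert v X) = (\<Sum>Y\<in>Pow X. f (insert v Y) * pexp f (X - Y))"
proof -
  have "insert v X - insert v Y = X - Y" for Y
    using assms by auto
  then show ?thesis
    using assms by (simp add: pexp_rec[of "insert v X" v] sum_blocks_insert)
qed

lemma sum_Pow_disjoint_swap:
  assumes "finite X"
  shows "(\<Sum>Y\<in>Pow X. \<Sum>W\<in>Pow (X - Y). h Y W) = (\<Sum>W\<in>Pow X. \<Sum>Y\<in>Pow (X - W). h Y W)"
  using assms
  by (subst (1 2) sum.Sigma)
    (auto intro!: sum.reindex_bij_witness[where i = prod.swap and j = prod.swap])

text \<open>A pair \<open>Y \<subseteq> W\<close> is the same as the disjoint pair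
  \<open>(Y, W - Y)\<close>; convolutions are rearranged through this form.\<close>

lemma sum_Pow_split:
  assumes "finite X"
  shows "(\<Sum>W\<in>Pow X. \<Sum>Y\<in>Pow W. h Y (W - Y)) = (\<Sum>Y\<in>Pow X. \<Sum>W\<in>Pow (X - Y). h Y W)"
  using assms finite_subset[OF _ assms]
  by (subst (1 2) sum.Sigma)
    (auto intro!: sum.reindex_bij_witness[where i = "\<lambda>(Y, W). (Y \<union> W, Y)"
        and j = "\<lambda>(W, Y). (Y, W - Y)"])

text \<open>Expanding the product labels each block \<open>f\<close> or \<open>g\<close>, and
  \<open>Y\<close> is the union of the blocks labelled \<open>f\<close>. This is the functional
  equation of the exponential; the induction singles out the block of one vertex
  \<open>v\<close>.\<close>

lemma pexp_add:
  assumes "finite X"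
  shows "pexp (\<lambda>B. f B + g B) X = (\<Sum>Y\<in>Pow X. pexp f Y * pexp g (X - Y))"
  using assms
proof (induction X rule: finite_psubset_induct)
  case (psubset X)
  show ?case
  proof (cases "X = {}")
    case False
    then obtain v X' where X: "X = insert v X'" "v \<notin> X'"
      by (metis all_not_in_conv mk_disjoint_insert)
    have fin: "finite X'"
      using psubset.hyps X by simp
    have IH: "pexp (\<lambda>B. f B + g B) Y = (\<Sum>W\<in>Pow Y. pexp f W * pexp g (Y - W))" if "Y \<subseteq> X'" for Y
      using psubset.IH[of Y] that X by auto
    have fsub: "finite W" if "W \<subseteq> X'" for W
      using that fin finite_subset by blast
    \<comment> \<open>The two sums separate whether the block of \<open>v\<close> carries
      \<open>f\<close> or \<open>g\<close>; each is then refolded into a partition sum over the part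
      that contains \<open>v\<close>.\<close>
    have "pexp (\<lambda>B. f B + g B) X
        = (\<Sum>Y\<in>Pow X'. \<Sum>W\<in>Pow (X' - Y). f (insert v Y) * (pexp f W * pexp g (X' - Y - W)))
        + (\<Sum>Y\<in>Pow X'. \<Sum>W\<in>Pow (X' - Y). g (insert v Y) * (pexp f W * pexp g (X' - Y - W)))"
      using X fin by (simp add: pexp_insert IH sum.distrib distrib_right sum_distrib_left)
    also have "(\<Sum>Y\<in>Pow X'. \<Sum>W\<in>Pow (X' - Y). f (insert v Y) * (pexp f W * pexp g (X' - Y - W)))
        = (\<Sum>Y\<in>Pow X'. \<Sum>W\<in>Pow Y. f (insert v W) * (pexp f (Y - W) * pexp g (X' - Y)))"
      unfolding sum_Pow_split[OF fin, symmetric]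
      by (intro sum.cong refl arg_cong2[of _ _ _ _ "(*)"] arg_cong2[of _ _ _ _ pexp]) auto
    also have "\<dots> = (\<Sum>Y\<in>Pow X'. pexp f (insert v Y) * pexp g (X' - Y))"
      using X fsub
      by (intro sum.cong refl, subst pexp_insert) (auto simp: sum_distrib_right mult.assoc)
    also have "(\<Sum>Y\<in>Pow X'. \<Sum>W\<in>Pow (X' - Y). g (insert v Y) * (pexp f W * pexp g (X' - Y - W)))
        = (\<Sum>W\<in>Pow X'. \<Sum>Y\<in>Pow (X' - W). g (insert v Y) * (pexp f W * pexp g (X' - Y - W)))"
      by (rule sum_Pow_disjoint_swap[OF fin])
    also have "\<dots> = (\<Sum>W\<in>Pow X'. pexp f W * pexp g (insert v (X' - W)))"
      using X fin
      by (intro sum.cong refl, subst pexp_insert)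
        (auto simp: sum_distrib_left algebra_simps Diff_eq Int_ac)
    also have "(\<Sum>Y\<in>Pow X'. pexp f (insert v Y) * pexp g (X' - Y))
          + (\<Sum>W\<in>Pow X'. pexp f W * pexp g (insert v (X' - W)))
        = (\<Sum>Y\<in>Pow X. pexp f Y * pexp g (X - Y))"
    proof -
      have "insert v X' - insert v Y = X' - Y" for Y using X by auto
      moreover have "insert v X' - W = insert v (X' - W)" if "W \<in> Pow X'" for W
        using X that by auto
      moreover have "Pow X' \<inter> insert v ` Pow X' = {}" using X by auto
      moreover have "inj_on (insert v) (Pow X')" using X by (auto simp: inj_on_def)
      ultimately show ?thesis
        using fin X by (simp add: Pow_insert sum.union_disjoint sum.reindex add.commute)
    qed
    finally show ?thesis .
  qed simp
qed

text \<open>The sizes of the blocks add up to \<open>card X\<close>.\<close>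

lemma pexp_scale:
  assumes "finite X"
  shows "pexp (\<lambda>B. c ^ card B * f B) X = c ^ card X * pexp f X"
  using assms
proof (induction X rule: finite_psubset_induct)
  case (psubset X)
  show ?case
  proof (cases "X = {}")
    case False
    then obtain v where v: "v \<in> X" by auto
    have "pexp (\<lambda>B. c ^ card B * f B) X
        = (\<Sum>B | B \<subseteq> X \<and> v \<in> B. c ^ card X * (f B * pexp f (X - B)))"
      unfolding pexp_rec[OF psubset.hyps v]
    proof (intro sum.cong refl)
      fix B assume "B \<in> {B. B \<subseteq> X \<and> v \<in> B}"
      then have B: "B \<subseteq> X" "v \<in> B" by auto
      then have "card X = card B + card (X - B)"
        using psubset.hyps by (metis card_Diff_subset card_mono finite_subset le_add_diff_inverse)
      moreover have "X - B \<subset> X"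
        using B v by auto
      ultimately show "c ^ card B * f B * pexp (\<lambda>B. c ^ card B * f B) (X - B)
          = c ^ card X * (f B * pexp f (X - B))"
        by (subst psubset.IH) (simp_all add: power_add mult_ac)
    qed
    then show ?thesis
      by (simp add: pexp_rec[OF psubset.hyps v] sum_distrib_left)
  qed simp
qed

lemma pexp_of_real: "pexp (\<lambda>B. of_real (f B)) X = (of_real (pexp f X) :: 'b::real_field)"
  by (simp add: pexp_def)

lemma pexp_nonneg:
  fixes f :: "'a set \<Rightarrow> real"
  assumes "\<And>B. B \<subseteq> X \<Longrightarrow> B \<noteq> {} \<Longrightarrow> 0 \<le> f B"
  shows "0 \<le> pexp f X"
  unfolding pexp_def by (intro sum_nonneg prod_nonneg assms) (auto simp: partition_on_def)

lemma norm_pexp_le: "norm (pexp f X) \<le> pexp (\<lambda>B. norm (f B)) X" for f :: "'a set \<Rightarrow> 'b::real_normed_field"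
  unfolding pexp_def by (rule order_trans[OF norm_sum]) (simp add: prod_norm)

lemma pexp_zero: "finite X \<Longrightarrow> pexp (\<lambda>B. 0) X = of_bool (X = {})"
  by (cases "X = {}") (auto simp: pexp_rec)

text \<open>The equation \<open>pexp (plog h) X = h X\<close>, solved for the term of the one-block partition \<open>{X}\<close>.\<close>

function plog :: "('a set \<Rightarrow> 'b::comm_ring_1) \<Rightarrow> 'a set \<Rightarrow> 'b" where
  "plog h X = (if finite X
     then h X - (\<Sum>\<pi>\<in>{\<pi>. partition_on X \<pi>} - {{X}}. \<Prod>B\<in>\<pi>. plog h B) else 0)"
  by auto
termination
proof (relation "measure (\<lambda>(h, X). card X)", goal_cases)
  case (2 h X \<pi> B)
  then have \<pi>: "partition_on X \<pi>" "\<pi> \<noteq> {X}" "B \<in> \<pi>" by auto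
  then have "B \<subseteq> X" "B \<noteq> {}" by (auto simp: partition_on_def)
  \<comment> \<open>A partition with \<open>X\<close> as a block has no other block, so the
    recursive calls concern proper subsets only.\<close>
  moreover have "B \<noteq> X"
  proof
    assume "B = X"
    have "C = X" if "C \<in> \<pi>" for C
    proof (rule ccontr)
      assume "C \<noteq> X"
      then have "C \<inter> X = {}"
        using \<pi> that \<open>B = X\<close> partition_onD2[OF \<pi>(1)] by (auto simp: disjoint_def)
      moreover have "C \<subseteq> X" "C \<noteq> {}"
        using \<pi>(1) that by (auto simp: partition_on_def)
      ultimately show False by auto
    qed
    then have "\<pi> = {X}"
      using \<pi>(3) \<open>B = X\<close> by blast
    with \<pi> show False by simp
  qed
  ultimately have "B \<subset> X" by blast
  moreover have "finite X" using 2 by auto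
  ultimately show ?case by (simp add: psubset_card_mono)
qed auto

declare plog.simps [simp del]

text \<open>The sum subtracted in \<open>plog h X\<close> is the contribution of all partitions
  other than \<open>{X}\<close>; the one-block term restores \<open>h X\<close>. At the empty set
  \<open>pexp\<close> is 1, hence the condition on \<open>h\<close>.\<close>

lemma pexp_plog:
  assumes "finite X" "h {} = 1"
  shows "pexp (plog h) X = h X"
proof (cases "X = {}")
  case False
  have "pexp (plog h) X = (\<Prod>B\<in>{X}. plog h B)
      + (\<Sum>\<pi>\<in>{\<pi>. partition_on X \<pi>} - {{X}}. \<Prod>B\<in>\<pi>. plog h B)"
    unfolding pexp_def using assms False
    by (intro sum.remove) (auto simp: finitely_many_partition_on partition_on_space)
  then show ?thesis
    using assms by (simp add: plog.simps[of h X])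
qed (use assms in simp)

subsection \<open>Cluster weights of a graph\<close>

definition neighbors :: "'a set set \<Rightarrow> 'a \<Rightarrow> 'a set" where
  "neighbors E v = {w. {v, w} \<in> E}"

lemma neighbors_sym: "w \<in> neighbors E v \<longleftrightarrow> v \<in> neighbors E w"
  by (simp add: neighbors_def insert_commute)

definition independent_set :: "'a set set \<Rightarrow> 'a set \<Rightarrow> bool" where
  "independent_set E X \<longleftrightarrow> (\<forall>u\<in>X. \<forall>v\<in>X. {u, v} \<notin> E)"

text \<open>This is the sum of \<open>(-1)\<^bsup>|A|\<^esup>\<close> over the connected spanning edge sets \<open>A\<close> of the subgraph induced by
  the given set of vertices.\<close>

definition cluster_weight :: "'a set set \<Rightarrow> 'a set \<Rightarrow> real" where
  "cluster_weight E = plog (\<lambda>X. of_bool (independent_set E X))"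

text \<open>By Whitney's theorem this is the number of spanning trees of the subgraph induced by \<open>B\<close> that
  contain no broken circuit.\<close>

definition tree_weight :: "'a set set \<Rightarrow> 'a set \<Rightarrow> real" where
  "tree_weight E B = - ((- 1) ^ card B * cluster_weight E B)"

lemma pexp_cluster_weight:
  "finite X \<Longrightarrow> pexp (cluster_weight E) X = of_bool (independent_set E X)"
  unfolding cluster_weight_def by (rule pexp_plog) (auto simp: independent_set_def)

section \<open>Counting colorings by partition sums\<close>

definition colorings :: "'a set set \<Rightarrow> 'a set \<Rightarrow> nat \<Rightarrow> ('a \<Rightarrow> nat) set" where
  "colorings E X q = {f \<in> X \<rightarrow>\<^sub>E {1..q}. \<forall>u\<in>X. \<forall>v\<in>X. {u, v} \<in> E \<longrightarrow> f u \<noteq> f v}"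

lemma finite_colorings: "finite X \<Longrightarrow> finite (colorings E X q)"
  unfolding colorings_def
  by (rule finite_subset[of _ "X \<rightarrow>\<^sub>E {1..q}"]) (auto intro: finite_PiE)

text \<open>Painting \<open>I\<close> with the color \<open>Suc q\<close> inverts the restriction;
  independence of \<open>I\<close> makes the painted map proper.\<close>

lemma bij_colorings_color_class:
  assumes "I \<subseteq> X" "independent_set E I"
  shows "bij_betw (\<lambda>f. restrict f (X - I))
    {f \<in> colorings E X (Suc q). {v \<in> X. f v = Suc q} = I} (colorings E (X - I) q)"
proof (rule bij_betwI[where g = "\<lambda>f v. if v \<in> I then Suc q else f v"], goal_cases)
  case 1
  show ?case
  proof
    fix f assume f: "f \<in> {f \<in> colorings E X (Suc q). {v \<in> X. f v = Suc q} = I}"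
    have "f v \<in> {1..q}" if "v \<in> X - I" for v
    proof -
      have "f v \<in> {1..Suc q}"
        using f that by (auto simp: colorings_def)
      moreover have "f v \<noteq> Suc q"
        using f that by blast
      ultimately show ?thesis by auto
    qed
    then show "restrict f (X - I) \<in> colorings E (X - I) q"
      using f by (auto simp: colorings_def)
  qed
next
  case 2
  show ?case
  proof
    fix f assume f: "f \<in> colorings E (X - I) q"
    have mem: "f v \<in> {1..q}" if "v \<in> X - I" for v
      using f that by (auto simp: colorings_def)
    have neq: "f v \<noteq> Suc q" "f v \<noteq> 0" "f v \<le> Suc q" if "v \<in> X - I" for v
      using mem[OF that] by auto
    let ?h = "\<lambda>v. if v \<in> I then Suc q else f v"
    have "?h \<in> X \<rightarrow>\<^sub>E {1..Suc q}"
    proof (rule PiE_I)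
      fix v assume "v \<notin> X"
      then show "?h v = undefined"
        using f assms(1) by (auto simp: colorings_def PiE_def extensional_def)
    qed (use neq in \<open>auto simp: Suc_le_eq\<close>)
    moreover have "?h u \<noteq> ?h v" if "u \<in> X" "v \<in> X" "{u, v} \<in> E" for u v
    proof (cases "u \<in> I \<or> v \<in> I")
      case True
      have "\<not> (u \<in> I \<and> v \<in> I)"
        using assms(2) that by (auto simp: independent_set_def)
      then show ?thesis
        using neq(1)[of u] neq(1)[of v] that True by (metis DiffI)
    next
      case False
      then show ?thesis
        using f that by (auto simp: colorings_def)
    qed
    moreover have "{v \<in> X. ?h v = Suc q} = I"
      using neq(1) assms(1) by auto
    ultimately show "?h \<in> {f \<in> colorings E X (Suc q). {v \<in> X. f v = Suc q} = I}"
      by (auto simp: colorings_def)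
  qed
next
  case (3 f)
  then have f: "f \<in> extensional X" "{v \<in> X. f v = Suc q} = I"
    by (auto simp: colorings_def PiE_def)
  show ?case
  proof
    fix v
    have "f v = Suc q" if "v \<in> I"
      using f(2) that by blast
    then show "(if v \<in> I then Suc q else restrict f (X - I) v) = f v"
      using f(1) by (simp add: extensional_def)
  qed
next
  case (4 f)
  then have f: "f \<in> extensional (X - I)"
    by (auto simp: colorings_def PiE_def)
  show ?case
  proof
    fix v
    show "restrict (\<lambda>v. if v \<in> I then Suc q else f v) (X - I) v = f v"
      using f by (auto simp: extensional_def)
  qed
qed

text \<open>Colorings are sorted by the class \<open>I\<close> of the last color. A set that
  contains an edge is a color class of none.\<close>

lemma card_colorings_Suc:
  assumes "finite X"
  shows "card (colorings E X (Suc q))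
    = (\<Sum>I\<in>Pow X. of_bool (independent_set E I) * card (colorings E (X - I) q))"
proof -
  let ?F = "\<lambda>I. {f \<in> colorings E X (Suc q). {v \<in> X. f v = Suc q} = I}"
  have "colorings E X (Suc q) = (\<Union>I\<in>Pow X. ?F I)"
    by (rule set_eqI) auto
  then have "card (colorings E X (Suc q)) = card (\<Union>I\<in>Pow X. ?F I)"
    by (rule arg_cong)
  also have "\<dots> = (\<Sum>I\<in>Pow X. card (?F I))"
  proof (rule card_UN_disjoint)
    show "\<forall>I\<in>Pow X. finite (?F I)"
      using finite_colorings[OF assms] by simp
    show "\<forall>I\<in>Pow X. \<forall>J\<in>Pow X. I \<noteq> J \<longrightarrow> ?F I \<inter> ?F J = {}"
      by (intro ballI impI equals0I) simp
  qed (use assms in simp)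
  also have "\<dots> = (\<Sum>I\<in>Pow X. of_bool (independent_set E I) * card (colorings E (X - I) q))"
  proof (intro sum.cong refl)
    fix I assume "I \<in> Pow X"
    then have I: "I \<subseteq> X" by simp
    show "card (?F I) = of_bool (independent_set E I) * card (colorings E (X - I) q)"
    proof (cases "independent_set E I")
      case True
      then show ?thesis
        by (simp only: bij_betw_same_card[OF bij_colorings_color_class[OF I True]] of_bool_eq mult_1)
    next
      case False
      then obtain u v where uv: "u \<in> I" "v \<in> I" "{u, v} \<in> E"
        unfolding independent_set_def by blast
      have disj: "f \<notin> ?F I" for f
      proof
        assume f: "f \<in> ?F I"
        then have "I = {v \<in> X. f v = Suc q}"
          by simp
        then have "f u = Suc q" "f v = Suc q"
          using uv(1,2) by simp_all
        moreover have "f u \<noteq> f v"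
          using f uv I by (auto simp: colorings_def)
        ultimately show False by simp
      qed
      have "?F I = {}"
        by (rule equals0I) (rule notE[OF disj])
      with False show ?thesis
        by (simp only: card.empty of_bool_eq mult_0)
    qed
  qed
  finally show ?thesis .
qed

text \<open>Each new color convolves the count with the indicator of independent sets, which is
  \<open>pexp (cluster_weight E)\<close>; by \<open>pexp_add\<close> this adds
  \<open>cluster_weight E\<close> to the exponent. Without colors only the empty set has a
  coloring.\<close>

lemma card_colorings_eq_pexp:
  assumes "finite X"
  shows "real (card (colorings E X q)) = pexp (\<lambda>B. real q * cluster_weight E B) X"
  using assms
proof (induction q arbitrary: X)
  case 0
  have "colorings E X 0 = (if X = {} then {\<lambda>_. undefined} else {})"
    by (auto simp: colorings_def PiE_def extensional_def)
  then show ?case using 0 by (simp add: pexp_zero)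
next
  case (Suc q)
  have "real (card (colorings E X (Suc q)))
      = (\<Sum>I\<in>Pow X. pexp (cluster_weight E) I * pexp (\<lambda>B. real q * cluster_weight E B) (X - I))"
    unfolding card_colorings_Suc[OF Suc.prems] of_nat_sum
    using Suc.prems finite_subset[OF _ Suc.prems]
    by (intro sum.cong refl) (auto simp: pexp_cluster_weight Suc.IH)
  also have "\<dots> = pexp (\<lambda>B. cluster_weight E B + real q * cluster_weight E B) X"
    by (rule pexp_add[OF Suc.prems, symmetric])
  also have "\<dots> = pexp (\<lambda>B. real (Suc q) * cluster_weight E B) X"
    by (simp add: algebra_simps)
  finally show ?case .
qed

text \<open>All edges lie inside \<open>V\<close>. In \<open>colorings\<close> the edges are
  restricted to \<open>X\<close>, so that the inductions can delete vertices while keeping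
  \<open>E\<close>.\<close>

lemma proper_colorings_eq:
  assumes "finite_simple_graph V E"
  shows "proper_colorings V E q = colorings E V q"
proof -
  have "u \<in> V \<and> v \<in> V" if "{u, v} \<in> E" for u v
    using assms that by (auto simp: finite_simple_graph_def)
  then show ?thesis
    unfolding proper_colorings_def colorings_def by blast
qed

text \<open>The partition sum is a polynomial in \<open>q\<close>, a partition with \<open>k\<close>
  blocks giving a monomial of degree \<open>k\<close>, and it counts colorings at natural
  numbers.\<close>

lemma poly_chromatic_poly:
  assumes "finite_simple_graph V E"
  shows "poly (chromatic_poly V E) q = pexp (\<lambda>B. q * complex_of_real (cluster_weight E B)) V"
proof -
  have fin: "finite V"
    using assms by (simp add: finite_simple_graph_def)
  define p where "p = (\<Sum>\<pi> | partition_on V \<pi>.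
    monom (\<Prod>B\<in>\<pi>. complex_of_real (cluster_weight E B)) (card \<pi>))"
  have poly_p: "poly p q = pexp (\<lambda>B. q * complex_of_real (cluster_weight E B)) V" for q
    by (auto simp: p_def pexp_def poly_sum poly_monom prod.distrib mult.commute)
  have p_nat: "poly p (of_nat k) = of_nat (card (proper_colorings V E k))" for k
  proof -
    have "poly p (of_nat k) = pexp (\<lambda>B. complex_of_real (real k * cluster_weight E B)) V"
      by (simp add: poly_p)
    also have "\<dots> = complex_of_real (real (card (proper_colorings V E k)))"
      by (simp only: pexp_of_real card_colorings_eq_pexp[OF fin] proper_colorings_eq[OF assms])
    finally show ?thesis by simp
  qed
  \<comment> \<open>Polynomials that agree at infinitely many points coincide, which settles the
    definite description in \<open>chromatic_poly\<close>.\<close>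
  have "p' = p" if p': "\<forall>k. 1 \<le> k \<longrightarrow> poly p' (of_nat k) = of_nat (card (proper_colorings V E k))" for p'
  proof (rule ccontr)
    assume "p' \<noteq> p"
    then have "finite {x. poly (p' - p) x = 0}"
      by (intro poly_roots_finite) simp
    moreover have "of_nat ` {1::nat..} \<subseteq> {x. poly (p' - p) x = 0}"
      using p' p_nat by auto
    ultimately have "finite (of_nat ` {1::nat..} :: complex set)"
      by (rule rev_finite_subset)
    then show False
      by (simp add: finite_image_iff inj_on_def infinite_Ici)
  qed
  then have "chromatic_poly V E = p"
    unfolding chromatic_poly_def using p_nat by (intro the_equality) auto
  then show ?thesis by (simp add: poly_p)
qed

section \<open>The recursion for cluster weights and tree weights\<close>

lemma pexp_avoiding:
  assumes "finite X"
  shows "pexp (\<lambda>B. of_bool (B \<inter> N = {}) * f B) X = of_bool (X \<inter> N = {}) * pexp f X"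
proof (cases "X \<inter> N = {}")
  case True
  then show ?thesis
    using pexp_cong[of X "\<lambda>B. of_bool (B \<inter> N = {}) * f B" f] by (simp add: disjoint_iff subset_iff)
next
  case False
  \<comment> \<open>The block of \<open>v\<close> meets \<open>N\<close>, so its factor kills every
    term.\<close>
  then obtain v where "v \<in> X" "v \<in> N" by auto
  then show ?thesis
    using assms unfolding pexp_rec[OF assms \<open>v \<in> X\<close>] by (subst sum.neutral) auto
qed

lemma independent_set_insert:
  assumes "{u} \<notin> E"
  shows "independent_set E (insert u Y) \<longleftrightarrow> independent_set E Y \<and> Y \<inter> neighbors E u = {}"
  using assms unfolding independent_set_def neighbors_def by (auto simp: insert_commute)

text \<open>Multiplying the indicator of independent sets by that of avoiding the neighbours of \<open>u\<close> removes from
  its logarithm the blocks that meet the neighbours. Convolution with the indicator is injective because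
  it is 1 at the empty set.\<close>

lemma cluster_weight_insert:
  assumes "finite Y" "u \<notin> Y" "{u} \<notin> E"
  shows "cluster_weight E (insert u Y)
    = pexp (\<lambda>B. of_bool (B \<inter> neighbors E u \<noteq> {}) * - cluster_weight E B) Y"
  using assms(1,2)
proof (induction Y rule: finite_psubset_induct)
  case (psubset Y)
  let ?w = "cluster_weight E"
  let ?h = "pexp (\<lambda>B. of_bool (B \<inter> neighbors E u \<noteq> {}) * - ?w B)"
  have *: "(\<Sum>W\<in>Pow Y. g W * pexp ?w (Y - W)) = g Y + (\<Sum>W\<in>Pow Y - {Y}. g W * pexp ?w (Y - W))"
    for g
    using psubset.hyps by (subst sum.remove[of _ Y]) auto
  have "(\<Sum>W\<in>Pow Y. ?w (insert u W) * pexp ?w (Y - W)) = pexp ?w (insert u Y)"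
    using psubset by (simp add: pexp_insert)
  also have "\<dots> = of_bool (Y \<inter> neighbors E u = {}) * pexp ?w Y"
    using psubset assms(3) by (auto simp: pexp_cluster_weight independent_set_insert)
  also have "\<dots> = pexp (\<lambda>B. of_bool (B \<inter> neighbors E u = {}) * ?w B) Y"
    using psubset by (simp add: pexp_avoiding)
  \<comment> \<open>Restricting to the avoiding blocks means subtracting the weights of the meeting
    ones; as a sum this becomes a convolution.\<close>
  also have "\<dots> = pexp (\<lambda>B. of_bool (B \<inter> neighbors E u \<noteq> {}) * - ?w B + ?w B) Y"
    by (rule pexp_cong) auto
  also have "\<dots> = (\<Sum>W\<in>Pow Y. ?h W * pexp ?w (Y - W))"
    by (rule pexp_add[OF psubset.hyps])
  finally have "?w (insert u Y) + (\<Sum>W\<in>Pow Y - {Y}. ?w (insert u W) * pexp ?w (Y - W))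
      = ?h Y + (\<Sum>W\<in>Pow Y - {Y}. ?h W * pexp ?w (Y - W))"
    unfolding * .
  moreover have "(\<Sum>W\<in>Pow Y - {Y}. ?w (insert u W) * pexp ?w (Y - W))
      = (\<Sum>W\<in>Pow Y - {Y}. ?h W * pexp ?w (Y - W))"
    using psubset by (intro sum.cong refl) auto
  ultimately show ?case by simp
qed

text \<open>The signs cancel: \<open>(- 1) ^ card Y\<close> is distributed over the blocks, where it
  combines with the minus sign of \<open>cluster_weight_insert\<close> to
  \<open>tree_weight\<close>.\<close>

lemma tree_weight_insert:
  assumes "finite Y" "u \<notin> Y" "{u} \<notin> E"
  shows "tree_weight E (insert u Y)
    = pexp (\<lambda>B. of_bool (B \<inter> neighbors E u \<noteq> {}) * tree_weight E B) Y"
proof -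
  have "tree_weight E (insert u Y) = (- 1) ^ card Y * cluster_weight E (insert u Y)"
    using assms by (simp add: tree_weight_def)
  also have "\<dots> = pexp (\<lambda>B. (- 1) ^ card B *
      (of_bool (B \<inter> neighbors E u \<noteq> {}) * - cluster_weight E B)) Y"
    by (simp only: cluster_weight_insert[OF assms] pexp_scale[OF assms(1)])
  also have "\<dots> = pexp (\<lambda>B. of_bool (B \<inter> neighbors E u \<noteq> {}) * tree_weight E B) Y"
    by (simp add: tree_weight_def mult_ac)
  finally show ?thesis .
qed

lemma tree_weight_nonneg:
  assumes "finite B" "B \<noteq> {}" "\<And>v. {v} \<notin> E"
  shows "0 \<le> tree_weight E B"
  using assms(1,2)
proof (induction B rule: finite_psubset_induct)
  case (psubset B)
  then obtain u Y where B: "B = insert u Y" "u \<notin> Y"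
    by (metis all_not_in_conv mk_disjoint_insert)
  then have "0 \<le> tree_weight E C" if "C \<subseteq> Y" "C \<noteq> {}" for C
    using that by (intro psubset.IH) auto
  then show ?case
    using B psubset.hyps assms(3)
    by (simp add: tree_weight_insert) (intro pexp_nonneg mult_nonneg_nonneg, auto)
qed

text \<open>Each block gives up a factor \<open>q ^ card B\<close>, and these multiply to
  \<open>q ^ card V\<close>. Dividing by \<open>- 1 / q\<close> writes the exponent
  \<open>card B - 1\<close> without truncated subtraction.\<close>

lemma poly_chromatic_poly_tree_weight:
  assumes "finite_simple_graph V E" "q \<noteq> 0"
  shows "poly (chromatic_poly V E) q
    = q ^ card V * pexp (\<lambda>B. (- 1 / q) ^ card B / (- 1 / q) * of_real (tree_weight E B)) V"
proof -
  have fin: "finite V"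
    using assms by (simp add: finite_simple_graph_def)
  have "q * of_real (cluster_weight E B)
      = q ^ card B * ((- 1 / q) ^ card B / (- 1 / q) * of_real (tree_weight E B))" for B
  proof -
    have "q ^ card B * (- 1 / q) ^ card B * (- 1) ^ card B = 1"
      using assms(2) by (simp flip: power_mult_distrib)
    moreover have "q ^ card B * ((- 1 / q) ^ card B / (- 1 / q) * of_real (tree_weight E B))
        = (q ^ card B * (- 1 / q) ^ card B * (- 1) ^ card B) * (q * of_real (cluster_weight E B))"
      using assms(2) by (simp add: tree_weight_def)
    ultimately show ?thesis by simp
  qed
  then show ?thesis
    unfolding poly_chromatic_poly[OF assms(1)] by (simp only: pexp_scale[OF fin])
qed

subsection \<open>Sums over blocks meeting a given set\<close>

text \<open>The sum runs over families of disjoint blocks in \<open>X\<close> that each meet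
  \<open>N\<close>. At most one block contains \<open>n\<close> and misses the earlier elements of
  \<open>N\<close>; forgetting that it is disjoint from the other blocks leaves a product.\<close>

lemma sum_pexp_meeting_le:
  fixes f :: "'a set \<Rightarrow> real"
  assumes "finite X" "N \<subseteq> X" and nonneg: "\<And>B. B \<subseteq> X \<Longrightarrow> B \<noteq> {} \<Longrightarrow> 0 \<le> f B"
  shows "(\<Sum>Y\<in>Pow X. pexp (\<lambda>B. of_bool (B \<inter> N \<noteq> {}) * f B) Y)
    \<le> (\<Prod>n\<in>N. 1 + (\<Sum>B | B \<subseteq> X \<and> n \<in> B. f B))"
proof -
  have "finite N"
    using assms(1,2) finite_subset by blast
  then show ?thesis
    using assms(2)
  proof (induction N rule: finite_induct)
    case empty
    have "(\<Sum>Y\<in>Pow X. pexp (\<lambda>B. of_bool (B \<inter> {} \<noteq> {}) * f B) Y) = (\<Sum>Y\<in>Pow X. of_bool (Y = {}))"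
      using finite_subset[OF _ assms(1)] by (intro sum.cong) (auto simp: pexp_zero)
    also have "\<dots> = 1"
      using assms(1) by (simp add: sum.remove[of _ "{}"])
    finally show ?case by simp
  next
    case (insert n N)
    let ?P = "pexp (\<lambda>B. of_bool (B \<inter> N \<noteq> {}) * f B)"
    let ?q = "\<lambda>B. of_bool (n \<in> B \<and> B \<inter> N = {}) * f B"
    have fin: "finite Y" if "Y \<subseteq> X" for Y
      using that assms(1) finite_subset by blast
    have P_nonneg: "0 \<le> ?P Y" if "Y \<subseteq> X" for Y
      using that nonneg by (intro pexp_nonneg mult_nonneg_nonneg) auto
    have q_nonneg: "0 \<le> pexp ?q Y" if "Y \<subseteq> X" for Y
      using that nonneg by (intro pexp_nonneg mult_nonneg_nonneg) auto
    have q_outside: "pexp ?q U = of_bool (U = {})" if "U \<subseteq> X" "n \<notin> U" for U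
    proof -
      have "pexp ?q U = pexp (\<lambda>_. 0) U"
        by (rule pexp_cong) (use that in auto)
      then show ?thesis
        using fin[OF that(1)] by (simp add: pexp_zero)
    qed
    \<comment> \<open>Disjoint blocks cannot share \<open>n\<close>, so only the one-block partition
      survives.\<close>
    have q_le: "pexp ?q U \<le> of_bool (U = {}) + of_bool (n \<in> U) * f U" if U: "U \<subseteq> X" for U
    proof (cases "n \<in> U")
      case True
      have "pexp ?q U = (\<Sum>B | B \<subseteq> U \<and> n \<in> B. ?q B * pexp ?q (U - B))"
        using True fin[OF U] by (rule pexp_rec[rotated])
      also have "\<dots> = (\<Sum>B\<in>{U}. ?q B * pexp ?q (U - B))"
      proof (rule sum.mono_neutral_right)
        show "\<forall>B\<in>{B. B \<subseteq> U \<and> n \<in> B} - {U}. ?q B * pexp ?q (U - B) = 0"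
        proof
          fix B assume B: "B \<in> {B. B \<subseteq> U \<and> n \<in> B} - {U}"
          then have "U - B \<subseteq> X" "n \<notin> U - B" "U - B \<noteq> {}"
            using U by auto
          then have "pexp ?q (U - B) = 0"
            by (subst q_outside) simp_all
          then show "?q B * pexp ?q (U - B) = 0"
            by simp
        qed
      qed (use True fin[OF U] in auto)
      also have "\<dots> \<le> f U"
        using nonneg[OF U] True by (cases "U \<inter> N = {}") auto
      finally show ?thesis using True by auto
    qed (use q_outside[OF U] in simp)
    have "(\<Sum>Y\<in>Pow X. pexp (\<lambda>B. of_bool (B \<inter> insert n N \<noteq> {}) * f B) Y)
        = (\<Sum>Y\<in>Pow X. pexp (\<lambda>B. of_bool (B \<inter> N \<noteq> {}) * f B + ?q B) Y)"
      by (intro sum.cong refl pexp_cong) auto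
    also have "\<dots> = (\<Sum>Y\<in>Pow X. \<Sum>W\<in>Pow Y. ?P W * pexp ?q (Y - W))"
      using fin by (intro sum.cong refl pexp_add) auto
    also have "\<dots> = (\<Sum>W\<in>Pow X. \<Sum>U\<in>Pow (X - W). ?P W * pexp ?q U)"
      by (rule sum_Pow_split[OF assms(1)])
    also have "\<dots> \<le> (\<Sum>W\<in>Pow X. \<Sum>U\<in>Pow X. ?P W * pexp ?q U)"
      using assms(1) P_nonneg q_nonneg by (intro sum_mono sum_mono2) auto
    also have "\<dots> = (\<Sum>W\<in>Pow X. ?P W) * (\<Sum>U\<in>Pow X. pexp ?q U)"
      by (simp add: sum_product)
    also have "\<dots> \<le> (\<Prod>n\<in>N. 1 + (\<Sum>B | B \<subseteq> X \<and> n \<in> B. f B)) * (1 + (\<Sum>B | B \<subseteq> X \<and> n \<in> B. f B))"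
    proof (rule mult_mono)
      show "(\<Sum>W\<in>Pow X. ?P W) \<le> (\<Prod>n\<in>N. 1 + (\<Sum>B | B \<subseteq> X \<and> n \<in> B. f B))"
        using insert by simp
      have "(\<Sum>U\<in>Pow X. pexp ?q U) \<le> (\<Sum>U\<in>Pow X. of_bool (U = {}) + of_bool (n \<in> U) * f U)"
        by (intro sum_mono q_le) auto
      also have "\<dots> = (\<Sum>U\<in>Pow X. of_bool (U = {})) + (\<Sum>U\<in>Pow X. of_bool (n \<in> U) * f U)"
        by (rule sum.distrib)
      also have "(\<Sum>U\<in>Pow X. of_bool (U = {})) = (1 :: real)"
        using assms(1) by (simp add: sum.remove[of _ "{}"])
      also have "(\<Sum>U\<in>Pow X. of_bool (n \<in> U) * f U) = (\<Sum>B | B \<subseteq> X \<and> n \<in> B. f B)"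
        using assms(1) by (intro sum.mono_neutral_cong_right) auto
      finally show "(\<Sum>U\<in>Pow X. pexp ?q U) \<le> 1 + (\<Sum>B | B \<subseteq> X \<and> n \<in> B. f B)" .
      show "0 \<le> (\<Prod>n\<in>N. 1 + (\<Sum>B | B \<subseteq> X \<and> n \<in> B. f B))"
        using nonneg by (intro prod_nonneg add_nonneg_nonneg sum_nonneg) auto
      show "0 \<le> (\<Sum>U\<in>Pow X. pexp ?q U)"
        using q_nonneg by (intro sum_nonneg) auto
    qed
    finally show ?case
      using insert by (simp add: mult.commute)
  qed
qed

text \<open>The block \<open>B\<close> of \<open>t\<close> meets \<open>N\<close> in some
  \<open>n\<close>. The other blocks lie in \<open>X - B\<close> and meet \<open>N - B\<close>, a
  subset of \<open>N - {n}\<close>, so that \<open>sum_pexp_meeting_le\<close> bounds them.\<close>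

lemma sum_pexp_meeting_through_le:
  fixes f :: "'a set \<Rightarrow> real"
  assumes "finite X" "N \<subseteq> X" "t \<in> X" and nonneg: "\<And>B. B \<subseteq> X \<Longrightarrow> B \<noteq> {} \<Longrightarrow> 0 \<le> f B"
  shows "(\<Sum>Y | Y \<subseteq> X \<and> t \<in> Y. pexp (\<lambda>B. of_bool (B \<inter> N \<noteq> {}) * f B) Y)
    \<le> (\<Sum>n\<in>N. (\<Sum>B | B \<subseteq> X \<and> n \<in> B \<and> t \<in> B. f B)
        * (\<Prod>m\<in>N - {n}. 1 + (\<Sum>B | B \<subseteq> X \<and> m \<in> B. f B)))"
proof -
  let ?h = "\<lambda>B. of_bool (B \<inter> N \<noteq> {}) * f B"
  let ?F = "\<lambda>m X. 1 + (\<Sum>B | B \<subseteq> X \<and> m \<in> B. f B)"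
  obtain X0 where X: "X = insert t X0" "t \<notin> X0"
    using assms(3) by (metis mk_disjoint_insert)
  have fin: "finite Y" if "Y \<subseteq> X" for Y
    using that assms(1) finite_subset by blast
  have finN: "finite N"
    using fin[OF assms(2)] .
  have F_ge_1: "1 \<le> ?F m Y" if "Y \<subseteq> X" for m Y
    using nonneg that by (simp, intro sum_nonneg) auto
  have F_mono: "?F m Y \<le> ?F m X" if "Y \<subseteq> X" for m Y
    using nonneg that assms(1)
    by (intro add_left_mono sum_mono2) (auto intro: finite_subset[of _ "Pow X"])
  have rest: "(\<Sum>U\<in>Pow (X - B). pexp ?h U) \<le> (\<Prod>m\<in>N - {n}. ?F m X)" if "n \<in> B" "B \<subseteq> X" for n B
  proof -
    have "(\<Sum>U\<in>Pow (X - B). pexp ?h U)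
        = (\<Sum>U\<in>Pow (X - B). pexp (\<lambda>C. of_bool (C \<inter> (N - B) \<noteq> {}) * f C) U)"
      by (intro sum.cong refl pexp_cong) (auto intro: arg_cong2[of _ _ _ _ "(*)"])
    also have "\<dots> \<le> (\<Prod>m\<in>N - B. ?F m (X - B))"
      using assms nonneg by (intro sum_pexp_meeting_le) auto
    also have "\<dots> \<le> (\<Prod>m\<in>N - B. ?F m X)"
      using F_ge_1[of "X - B"] F_mono[of "X - B"]
      by (intro prod_mono conjI order_trans[OF zero_le_one]) auto
    also have "\<dots> \<le> (\<Prod>m\<in>N - {n}. ?F m X)"
      using that finN F_ge_1[of X] by (intro prod_mono2) (auto intro: order_trans[OF zero_le_one])
    finally show ?thesis .
  qed
  have h_nonneg: "0 \<le> pexp ?h U" if "U \<subseteq> X" for U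
    using that nonneg by (intro pexp_nonneg mult_nonneg_nonneg) auto
  have "(\<Sum>Y | Y \<subseteq> X \<and> t \<in> Y. pexp ?h Y) = (\<Sum>Y\<in>Pow X0. pexp ?h (insert t Y))"
    unfolding X(1) by (rule sum_blocks_insert[OF X(2)])
  also have "\<dots> = (\<Sum>Y\<in>Pow X0. \<Sum>B\<in>Pow Y. ?h (insert t B) * pexp ?h (Y - B))"
    using X fin by (intro sum.cong refl pexp_insert) auto
  also have "\<dots> = (\<Sum>B\<in>Pow X0. \<Sum>U\<in>Pow (X0 - B). ?h (insert t B) * pexp ?h U)"
    using fin[of X0] X by (intro sum_Pow_split) auto
  also have "\<dots> = (\<Sum>B\<in>Pow X0. ?h (insert t B) * (\<Sum>U\<in>Pow (X - insert t B). pexp ?h U))"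
  proof -
    have "X - insert t B = X0 - B" for B
      using X by auto
    then show ?thesis by (simp only: sum_distrib_left)
  qed
  also have "\<dots> = (\<Sum>B | B \<subseteq> X \<and> t \<in> B. ?h B * (\<Sum>U\<in>Pow (X - B). pexp ?h U))"
    unfolding X(1) by (rule sum_blocks_insert[OF X(2), symmetric])
  \<comment> \<open>One element of \<open>B \<inter> N\<close> would do; summing over all of them
    only adds nonnegative terms.\<close>
  also have "\<dots> \<le> (\<Sum>B | B \<subseteq> X \<and> t \<in> B. \<Sum>n\<in>N. of_bool (n \<in> B) * f B * (\<Prod>m\<in>N - {n}. ?F m X))"
  proof (rule sum_mono)
    fix B assume "B \<in> {B. B \<subseteq> X \<and> t \<in> B}"
    then have B: "B \<subseteq> X" "t \<in> B" by auto
    have term_nonneg: "0 \<le> of_bool (n \<in> B) * f B * (\<Prod>m\<in>N - {n}. ?F m X)" for n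
      using nonneg[of B] B F_ge_1[of X]
      by (intro mult_nonneg_nonneg prod_nonneg) (auto intro: order_trans[OF zero_le_one])
    show "?h B * (\<Sum>U\<in>Pow (X - B). pexp ?h U)
        \<le> (\<Sum>n\<in>N. of_bool (n \<in> B) * f B * (\<Prod>m\<in>N - {n}. ?F m X))"
    proof (cases "B \<inter> N = {}")
      case True
      then show ?thesis
        using term_nonneg by (simp add: sum_nonneg)
    next
      case False
      then obtain n where n: "n \<in> B" "n \<in> N" by auto
      then have "?h B * (\<Sum>U\<in>Pow (X - B). pexp ?h U) \<le> f B * (\<Prod>m\<in>N - {n}. ?F m X)"
        using rest[OF n(1) B(1)] nonneg[of B] B
        by (intro mult_mono sum_nonneg h_nonneg) auto
      also have "\<dots> = of_bool (n \<in> B) * f B * (\<Prod>m\<in>N - {n}. ?F m X)"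
        using n by simp
      also have "\<dots> \<le> (\<Sum>n\<in>N. of_bool (n \<in> B) * f B * (\<Prod>m\<in>N - {n}. ?F m X))"
        by (rule member_le_sum[OF n(2) term_nonneg finN])
      finally show ?thesis .
    qed
  qed
  also have "\<dots> = (\<Sum>n\<in>N. (\<Sum>B | B \<subseteq> X \<and> t \<in> B. of_bool (n \<in> B) * f B) * (\<Prod>m\<in>N - {n}. ?F m X))"
    by (subst sum.swap) (simp add: sum_distrib_right)
  also have "\<dots> = (\<Sum>n\<in>N. (\<Sum>B | B \<subseteq> X \<and> n \<in> B \<and> t \<in> B. f B) * (\<Prod>m\<in>N - {n}. ?F m X))"
  proof -
    have "finite {B. B \<subseteq> X \<and> t \<in> B}"
      using assms(1) by (auto intro: finite_subset[of _ "Pow X"])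
    then have "(\<Sum>B | B \<subseteq> X \<and> t \<in> B. of_bool (n \<in> B) * f B)
        = (\<Sum>B | B \<subseteq> X \<and> n \<in> B \<and> t \<in> B. f B)" for n
      by (intro sum.mono_neutral_cong_right) auto
    then show ?thesis by (simp only:)
  qed
  finally show ?thesis .
qed

subsection \<open>Rooted sums in graphs of bounded degree\<close>

text \<open>The list consists of vertices, so \<open>d < length p\<close> says that the path has at
  least \<open>d\<close> edges.\<close>

definition path_between :: "'a set set \<Rightarrow> 'a set \<Rightarrow> 'a \<Rightarrow> 'a \<Rightarrow> 'a list \<Rightarrow> bool" where
  "path_between E X s t p \<longleftrightarrow> p \<noteq> [] \<and> hd p = s \<and> last p = t \<and> distinct p \<and> set p \<subseteq> X \<and>
     successively (\<lambda>u v. {u, v} \<in> E) p"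

lemma path_between_Cons:
  assumes "path_between E X n t p" "{s, n} \<in> E" "s \<notin> X"
  shows "path_between E (insert s X) s t (s # p)"
  using assms by (cases p) (auto simp: path_between_def)

text \<open>Here \<open>\<beta>\<close> stands for \<open>b powr (1 / \<Delta>)\<close>. Then
  \<open>x_le\<close> says that \<open>x\<close> is at most \<open>x_fun \<Delta> b\<close>, and
  \<open>ratio_less_1\<close> says that \<open>b < rho \<Delta>\<close>.\<close>

locale bounded_degree_weights =
  fixes E :: "'a set set" and \<Delta> :: nat and x \<beta> :: real
  assumes no_loop: "{v} \<notin> E"
    and finite_neighbors: "finite (neighbors E v)"
    and degree_le: "card (neighbors E v) \<le> \<Delta>"
    and Delta: "3 \<le> \<Delta>"
    and x_nonneg: "0 \<le> x"
    and beta_gt_1: "1 < \<beta>"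
    and x_le: "x * \<beta> ^ (\<Delta> - 1) \<le> \<beta> - 1"
    and ratio_less_1: "(real \<Delta> - 1) * (1 - 1 / \<beta>) < 1"
begin

definition wt :: "'a set \<Rightarrow> real" where
  "wt B = x ^ card B * tree_weight E B"

definition rooted :: "'a set \<Rightarrow> 'a \<Rightarrow> real" where
  "rooted X s = (\<Sum>B | B \<subseteq> X \<and> s \<in> B. wt B)"

definition birooted :: "'a set \<Rightarrow> 'a \<Rightarrow> 'a \<Rightarrow> real" where
  "birooted X s t = (\<Sum>B | B \<subseteq> X \<and> s \<in> B \<and> t \<in> B. wt B)"

text \<open>This is \<open>f_fun \<Delta> d (\<beta> ^ \<Delta>)\<close>. For
  \<open>d \<ge> 1\<close> it is the geometric series of
  \<open>(\<Delta> - 1) ^ (k - 1) * (1 - 1 / \<beta>) ^ k\<close> over \<open>k \<ge> d\<close>: a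
  bound for the number of paths with \<open>k\<close> edges to a fixed end, times the cost of
  \<open>k\<close> steps.\<close>

definition path_sum :: "nat \<Rightarrow> real" where
  "path_sum d = 1 / (real \<Delta> - 1) *
     (((real \<Delta> - 1) * (1 - 1 / \<beta>)) ^ d / (1 - (real \<Delta> - 1) * (1 - 1 / \<beta>)))"

lemma beta_ge_1: "1 \<le> \<beta>"
  using beta_gt_1 by simp

lemma self_not_neighbor: "s \<notin> neighbors E s"
  using no_loop[of s] by (simp add: neighbors_def)

lemma wt_nonneg: "finite B \<Longrightarrow> B \<noteq> {} \<Longrightarrow> 0 \<le> wt B"
  unfolding wt_def using x_nonneg no_loop by (intro mult_nonneg_nonneg tree_weight_nonneg) auto

lemma wt_insert:
  assumes "finite Y" "s \<notin> Y"
  shows "wt (insert s Y) = x * pexp (\<lambda>B. of_bool (B \<inter> neighbors E s \<noteq> {}) * wt B) Y"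
proof -
  have "pexp (\<lambda>B. of_bool (B \<inter> neighbors E s \<noteq> {}) * wt B) Y
      = pexp (\<lambda>B. x ^ card B * (of_bool (B \<inter> neighbors E s \<noteq> {}) * tree_weight E B)) Y"
    by (simp add: wt_def mult_ac)
  then show ?thesis
    using assms no_loop by (simp add: wt_def tree_weight_insert pexp_scale)
qed

lemma rooted_nonneg: "finite X \<Longrightarrow> 0 \<le> rooted X s"
  unfolding rooted_def by (intro sum_nonneg wt_nonneg) (auto intro: finite_subset)

lemma birooted_nonneg: "finite X \<Longrightarrow> 0 \<le> birooted X s t"
  unfolding birooted_def by (intro sum_nonneg wt_nonneg) (auto intro: finite_subset)

lemma birooted_same: "birooted X s s = rooted X s"
  by (simp add: birooted_def rooted_def)

lemma card_neighbors_Int_le: "card (neighbors E n \<inter> X) \<le> \<Delta>"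
  using degree_le[of n] card_mono[OF finite_neighbors[of n], of "neighbors E n \<inter> X"] by simp

text \<open>The neighbor \<open>s\<close> of \<open>n\<close> lies outside \<open>X\<close>. This
  turns \<open>\<Delta>\<close> into \<open>\<Delta> - 1\<close> whenever a recursion moves on from
  \<open>s\<close> to \<open>n\<close>.\<close>

lemma card_neighbors_Int_less:
  assumes "n \<in> neighbors E s" "s \<notin> X"
  shows "card (neighbors E n \<inter> X) \<le> \<Delta> - 1"
proof -
  have "s \<in> neighbors E n"
    using assms(1) neighbors_sym by metis
  then have "neighbors E n \<inter> X \<subset> neighbors E n"
    using assms(2) by auto
  then have "card (neighbors E n \<inter> X) < card (neighbors E n)"
    by (rule psubset_card_mono[OF finite_neighbors])
  then show ?thesis
    using degree_le[of n] by simp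
qed

lemma sum_pexp_meeting_neighbors_le:
  assumes "finite X"
  shows "(\<Sum>Y\<in>Pow X. pexp (\<lambda>B. of_bool (B \<inter> N \<noteq> {}) * wt B) Y) \<le> (\<Prod>n\<in>N \<inter> X. 1 + rooted X n)"
proof -
  have "(\<Sum>Y\<in>Pow X. pexp (\<lambda>B. of_bool (B \<inter> N \<noteq> {}) * wt B) Y)
      = (\<Sum>Y\<in>Pow X. pexp (\<lambda>B. of_bool (B \<inter> (N \<inter> X) \<noteq> {}) * wt B) Y)"
    by (intro sum.cong refl pexp_cong arg_cong2[of _ _ _ _ "(*)"] arg_cong[of _ _ of_bool]) auto
  also have "\<dots> \<le> (\<Prod>n\<in>N \<inter> X. 1 + rooted X n)"
    unfolding rooted_def using assms
    by (intro sum_pexp_meeting_le wt_nonneg) (auto intro: finite_subset)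
  finally show ?thesis .
qed

text \<open>Without \<open>s\<close>, a block falls into blocks that each contain a neighbor of
  \<open>s\<close>. Each neighbor has lost \<open>s\<close>, so by induction and \<open>x_le\<close>
  its factor is at most \<open>1 + x * \<beta> ^ (\<Delta> - 1) \<le> \<beta>\<close>.\<close>

lemma rooted_le_power:
  assumes "finite X" "s \<in> X"
  shows "rooted X s \<le> x * \<beta> ^ card (neighbors E s \<inter> X)"
  using assms
proof (induction X arbitrary: s rule: finite_psubset_induct)
  case (psubset X)
  then obtain Y where X: "X = insert s Y" "s \<notin> Y"
    by (meson mk_disjoint_insert)
  have fin: "finite Y" using psubset.hyps X by simp
  have "rooted X s = (\<Sum>W\<in>Pow Y. wt (insert s W))"
    unfolding rooted_def X(1) by (rule sum_blocks_insert[OF X(2)])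
  also have "\<dots> = x * (\<Sum>W\<in>Pow Y. pexp (\<lambda>B. of_bool (B \<inter> neighbors E s \<noteq> {}) * wt B) W)"
    unfolding sum_distrib_left using X finite_subset[OF _ fin]
    by (intro sum.cong refl wt_insert) auto
  also have "\<dots> \<le> x * (\<Prod>n\<in>neighbors E s \<inter> Y. 1 + rooted Y n)"
    using x_nonneg fin by (intro mult_left_mono sum_pexp_meeting_neighbors_le)
  also have "\<dots> \<le> x * (\<Prod>n\<in>neighbors E s \<inter> Y. \<beta>)"
  proof (intro mult_left_mono prod_mono conjI)
    fix n assume n: "n \<in> neighbors E s \<inter> Y"
    have "rooted Y n \<le> x * \<beta> ^ card (neighbors E n \<inter> Y)"
      using X n by (intro psubset.IH) auto
    also have "\<dots> \<le> x * \<beta> ^ (\<Delta> - 1)"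
      using n X card_neighbors_Int_less[of n s Y] x_nonneg beta_ge_1
      by (intro mult_left_mono power_increasing) auto
    finally show "1 + rooted Y n \<le> \<beta>"
      using x_le by simp
    show "0 \<le> 1 + rooted Y n"
      using rooted_nonneg[OF fin, of n] by simp
  qed (rule x_nonneg)
  also have "\<dots> = x * \<beta> ^ card (neighbors E s \<inter> X)"
    using X self_not_neighbor[of s] by (simp add: Int_insert_right)
  finally show ?case .
qed

lemma rooted_le:
  assumes "finite X" "s \<in> X"
  shows "rooted X s \<le> x * \<beta> ^ \<Delta>"
  using rooted_le_power[OF assms] x_nonneg beta_ge_1 card_neighbors_Int_le[of s X]
    mult_left_mono[OF power_increasing[of _ \<Delta> \<beta>] x_nonneg] by (metis order_trans)

lemma rooted_le_pred:
  assumes "finite X" "n \<in> X" "n \<in> neighbors E s" "s \<notin> X"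
  shows "1 + rooted X n \<le> \<beta>"
proof -
  have "rooted X n \<le> x * \<beta> ^ card (neighbors E n \<inter> X)"
    by (rule rooted_le_power[OF assms(1,2)])
  also have "\<dots> \<le> x * \<beta> ^ (\<Delta> - 1)"
    using card_neighbors_Int_less[OF assms(3,4)] x_nonneg beta_ge_1
    by (intro mult_left_mono power_increasing) auto
  finally show ?thesis using x_le by simp
qed

text \<open>The cost of one step along a path: \<open>x\<close> for the vertex left, and
  \<open>\<beta>\<close> for each of its at most \<open>\<Delta> - 2\<close> neighbors off the
  path.\<close>

lemma x_power_le: "x * \<beta> ^ (\<Delta> - 2) \<le> 1 - 1 / \<beta>"
proof -
  have "\<Delta> - 1 = Suc (\<Delta> - 2)"
    using Delta by simp
  then have "x * \<beta> ^ (\<Delta> - 2) * \<beta> \<le> \<beta> - 1"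
    using x_le by (simp add: mult_ac)
  then show ?thesis
    using beta_ge_1 by (simp add: field_simps)
qed

text \<open>Once \<open>s\<close> is removed, the piece containing \<open>t\<close> contains a
  neighbor \<open>n\<close> of \<open>s\<close>; the pieces at the other neighbors cost at most
  \<open>\<beta>\<close> each.\<close>

lemma birooted_insert_le:
  assumes "finite X" "s \<notin> X" "t \<in> X" "card (neighbors E s \<inter> X) \<le> \<Delta> - 1"
  shows "birooted (insert s X) s t \<le> (1 - 1 / \<beta>) * (\<Sum>n\<in>neighbors E s \<inter> X. birooted X n t)"
proof -
  let ?N = "neighbors E s \<inter> X"
  have finN: "finite ?N"
    using assms(1) by simp
  have "birooted (insert s X) s t
      = (\<Sum>B | B \<subseteq> insert s X \<and> s \<in> B. of_bool (t \<in> B) * wt B)"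
    unfolding birooted_def using assms(1)
    by (intro sum.mono_neutral_cong_left) (auto intro: finite_subset[of _ "Pow (insert s X)"])
  also have "\<dots> = (\<Sum>Y\<in>Pow X. of_bool (t \<in> insert s Y) * wt (insert s Y))"
    by (rule sum_blocks_insert[OF assms(2)])
  also have "\<dots> = (\<Sum>Y | Y \<subseteq> X \<and> t \<in> Y. wt (insert s Y))"
    using assms by (intro sum.mono_neutral_cong_right) auto
  also have "\<dots> = x * (\<Sum>Y | Y \<subseteq> X \<and> t \<in> Y. pexp (\<lambda>B. of_bool (B \<inter> ?N \<noteq> {}) * wt B) Y)"
    unfolding sum_distrib_left
  proof (intro sum.cong refl)
    fix Y assume "Y \<in> {Y. Y \<subseteq> X \<and> t \<in> Y}"
    then have Y: "Y \<subseteq> X" "finite Y" "s \<notin> Y"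
      using assms finite_subset by auto
    have "pexp (\<lambda>B. of_bool (B \<inter> neighbors E s \<noteq> {}) * wt B) Y
        = pexp (\<lambda>B. of_bool (B \<inter> ?N \<noteq> {}) * wt B) Y"
      using Y(1)
      by (intro pexp_cong arg_cong2[of _ _ _ _ "(*)"] arg_cong[of _ _ of_bool] refl) auto
    then show "wt (insert s Y) = x * pexp (\<lambda>B. of_bool (B \<inter> ?N \<noteq> {}) * wt B) Y"
      using Y by (simp add: wt_insert)
  qed
  also have "\<dots> \<le> x * (\<Sum>n\<in>?N. birooted X n t * (\<Prod>m\<in>?N - {n}. 1 + rooted X m))"
    unfolding birooted_def rooted_def using assms x_nonneg
    by (intro mult_left_mono sum_pexp_meeting_through_le wt_nonneg) (auto intro: finite_subset)
  also have "\<dots> = (\<Sum>n\<in>?N. birooted X n t * (x * (\<Prod>m\<in>?N - {n}. 1 + rooted X m)))"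
    by (simp add: sum_distrib_left mult_ac)
  also have "\<dots> \<le> (\<Sum>n\<in>?N. birooted X n t * (1 - 1 / \<beta>))"
  proof (intro sum_mono mult_left_mono birooted_nonneg assms(1))
    fix n assume n: "n \<in> ?N"
    have "x * (\<Prod>m\<in>?N - {n}. 1 + rooted X m) \<le> x * (\<Prod>m\<in>?N - {n}. \<beta>)"
      using assms rooted_le_pred rooted_nonneg[OF assms(1)] x_nonneg
      by (intro mult_left_mono prod_mono conjI) (auto simp: add_nonneg_nonneg)
    also have "\<dots> = x * \<beta> ^ (card ?N - 1)"
      using n finN by simp
    also have "\<dots> \<le> x * \<beta> ^ (\<Delta> - 2)"
      using assms(4) x_nonneg beta_ge_1 by (intro mult_left_mono power_increasing) auto
    finally show "x * (\<Prod>m\<in>?N - {n}. 1 + rooted X m) \<le> 1 - 1 / \<beta>"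
      using x_power_le by linarith
  qed
  finally show ?thesis
    by (simp add: sum_distrib_left mult.commute)
qed

lemma path_sum_nonneg: "0 \<le> path_sum d"
  unfolding path_sum_def using ratio_less_1 Delta beta_ge_1
  by (intro mult_nonneg_nonneg divide_nonneg_nonneg zero_le_power) auto

lemma path_sum_Suc: "path_sum (Suc d) = (1 - 1 / \<beta>) * ((real \<Delta> - 1) * path_sum d)"
  by (simp add: path_sum_def)

text \<open>The fixed point equation of the walk: a step either reaches the end or leads to one of
  \<open>\<Delta> - 1\<close> vertices from which the walk goes on.\<close>

lemma path_sum_1: "(1 - 1 / \<beta>) * (1 + (real \<Delta> - 1) * path_sum 1) = path_sum 1"
proof -
  define \<gamma> k where "\<gamma> = 1 - 1 / \<beta>" and "k = real \<Delta> - 1"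
  have "k \<noteq> 0" "1 - k * \<gamma> \<noteq> 0"
    using Delta ratio_less_1 by (auto simp: k_def \<gamma>_def)
  then have "\<gamma> * (1 + k * (1 / k * (k * \<gamma> / (1 - k * \<gamma>)))) = 1 / k * (k * \<gamma> / (1 - k * \<gamma>))"
    by (simp add: field_simps)
  then show ?thesis
    by (simp add: path_sum_def \<gamma>_def k_def)
qed

text \<open>Following the block containing \<open>t\<close> through the recursion at \<open>s\<close> traces out a path from \<open>s\<close> to \<open>t\<close>,
  each step of which costs a factor \<open>1 - 1 / \<beta>\<close>.\<close>

lemma birooted_le:
  assumes "finite X" "s \<in> X" "t \<in> X" "s \<noteq> t" "card (neighbors E s \<inter> X) \<le> \<Delta> - 1" "1 \<le> d"
    and "\<And>p. path_between E X s t p \<Longrightarrow> d < length p"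
  shows "birooted X s t \<le> x * \<beta> ^ \<Delta> * path_sum d"
  using assms
proof (induction X arbitrary: s d rule: finite_psubset_induct)
  case (psubset X)
  obtain Y where X: "X = insert s Y" "s \<notin> Y"
    using psubset.prems(1) by (meson mk_disjoint_insert)
  define c where "c = x * \<beta> ^ \<Delta>"
  define N where "N = neighbors E s \<inter> Y"
  have fin: "finite Y" "finite N"
    using psubset.hyps X by (simp_all add: N_def)
  have t: "t \<in> Y"
    using X psubset.prems by auto
  have "neighbors E s \<inter> X = N"
    using X self_not_neighbor[of s] by (auto simp: N_def)
  then have card_N: "card N \<le> \<Delta> - 1"
    using psubset.prems by simp
  then have card_N': "real (card N) \<le> real \<Delta> - 1"
    using Delta by linarith
  have c_nonneg: "0 \<le> c"
    using x_nonneg beta_ge_1 by (simp add: c_def)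
  have "birooted X s t \<le> (1 - 1 / \<beta>) * (\<Sum>n\<in>N. birooted Y n t)"
    unfolding X(1) N_def using X fin t card_N by (intro birooted_insert_le) (auto simp: N_def)
  also have "\<dots> \<le> (1 - 1 / \<beta>) * (path_sum d / (1 - 1 / \<beta>) * c)"
  proof (rule mult_left_mono)
    \<comment> \<open>Removing \<open>s\<close> shortens paths by one edge. For \<open>d = 1\<close>
      the bound 1 is kept, because \<open>n \<noteq> t\<close> forces an edge.\<close>
    have IH: "birooted Y n t \<le> c * path_sum d'"
      if "n \<in> N" "n \<noteq> t" "1 \<le> d'" "d' = 1 \<or> d' < d" for n d'
      unfolding c_def
    proof (rule psubset.IH)
      show "card (neighbors E n \<inter> Y) \<le> \<Delta> - 1"
        using that X by (intro card_neighbors_Int_less) (auto simp: N_def)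
      fix p assume p: "path_between E Y n t p"
      then have "1 < length p"
        using that(2) by (cases p rule: remdups_adj.cases) (auto simp: path_between_def)
      moreover have "path_between E X s t (s # p)"
        using p that X unfolding X(1) by (intro path_between_Cons) (auto simp: N_def neighbors_def)
      then have "d < Suc (length p)"
        using psubset.prems(6) by fastforce
      ultimately show "d' < length p"
        using that by auto
    qed (use X t that in \<open>auto simp: N_def\<close>)
    have gamma: "0 < 1 - 1 / \<beta>"
      using beta_gt_1 by (simp add: field_simps)
    have ps: "0 \<le> path_sum d'" for d'
      by (rule path_sum_nonneg)
    show "(\<Sum>n\<in>N. birooted Y n t) \<le> path_sum d / (1 - 1 / \<beta>) * c"
    proof (cases "d = 1")
      case True
      have "birooted Y n t \<le> of_bool (n = t) * c + c * path_sum 1" if "n \<in> N" for n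
      proof (cases "n = t")
        case True
        then show ?thesis
          using rooted_le[OF fin(1) t] mult_nonneg_nonneg[OF c_nonneg ps[of 1]]
          by (simp add: birooted_same c_def)
      qed (use IH[OF that, of 1] in simp)
      then have "(\<Sum>n\<in>N. birooted Y n t) \<le> (\<Sum>n\<in>N. of_bool (n = t) * c + c * path_sum 1)"
        by (rule sum_mono)
      also have "\<dots> = of_bool (t \<in> N) * c + real (card N) * (c * path_sum 1)"
        using fin(2) by (simp add: sum.distrib sum_distrib_right[symmetric] of_bool_def sum.delta')
      also have "\<dots> \<le> c + (real \<Delta> - 1) * (c * path_sum 1)"
        using c_nonneg ps[of 1] card_N' by (intro add_mono mult_right_mono) auto
      also have "\<dots> = (1 + (real \<Delta> - 1) * path_sum 1) * c"
        by (simp add: algebra_simps)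
      also have "1 + (real \<Delta> - 1) * path_sum 1 = path_sum d / (1 - 1 / \<beta>)"
        using path_sum_1 gamma unfolding True by (metis less_irrefl nonzero_mult_div_cancel_left)
      finally show ?thesis .
    next
      case False
      then obtain e where e: "d = Suc e" "1 \<le> e"
        using psubset.prems(5) by (cases d) auto
      \<comment> \<open>An edge from \<open>s\<close> to \<open>t\<close> would be a path with a
        single edge, while \<open>d \<ge> 2\<close>.\<close>
      have "t \<notin> N"
      proof
        assume "t \<in> N"
        then have "path_between E X s t [s, t]"
          using X t by (auto simp: path_between_def N_def neighbors_def)
        then show False
          using psubset.prems(6)[of "[s, t]"] False psubset.prems(5) by simp
      qed
      then have "(\<Sum>n\<in>N. birooted Y n t) \<le> (\<Sum>n\<in>N. c * path_sum e)"
        using e by (intro sum_mono IH) auto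
      also have "\<dots> = real (card N) * (c * path_sum e)"
        by simp
      also have "\<dots> \<le> (real \<Delta> - 1) * (c * path_sum e)"
        using c_nonneg ps[of e] card_N' by (intro mult_right_mono) auto
      also have "\<dots> = path_sum d / (1 - 1 / \<beta>) * c"
        using gamma unfolding e path_sum_Suc
        by (subst nonzero_mult_div_cancel_left) (auto simp: mult_ac)
      finally show ?thesis .
    qed
  qed (use beta_ge_1 in simp)
  also have "\<dots> = c * path_sum d"
    using beta_gt_1 by simp
  finally show ?case
    by (simp add: c_def)
qed

end

subsection \<open>Ratios of partition functions\<close>

text \<open>Removing a vertex will be shown to enlarge \<open>cmod (Z X)\<close> by at most the
  factor \<open>1 / (1 - a)\<close>. By \<open>x_eq\<close> the weights with parameter
  \<open>x\<close> carry this factor once for each vertex of a block.\<close>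

locale partition_function = bounded_degree_weights +
  fixes z :: complex and a :: real
  assumes z_nonzero: "z \<noteq> 0"
    and a_bounds: "0 \<le> a" "a < 1"
    and x_eq: "x * (1 - a) = cmod z"
begin

definition \<phi> :: "'a set \<Rightarrow> complex" where
  "\<phi> B = z ^ card B / z * of_real (tree_weight E B)"

definition Z :: "'a set \<Rightarrow> complex" where
  "Z = pexp \<phi>"

text \<open>Putting the neighbours of a vertex \<open>u\<close> into \<open>N\<close> one at a time leads from \<open>Z Y\<close> to \<open>Z (insert u Y)\<close>.\<close>

definition A :: "'a set \<Rightarrow> 'a set \<Rightarrow> complex" where
  "A N = pexp (\<lambda>B. of_bool (B \<inter> N \<noteq> {}) * (z * \<phi> B) + \<phi> B)"

text \<open>For \<open>k = \<Delta>\<close>, \<open>\<beta> ^ \<Delta> = b\<close>,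
  \<open>x = x_fun \<Delta> b\<close> and \<open>cmod z = (1 - a) * x\<close> this is
  \<open>K_fun \<Delta> g a b\<close>; \<open>k\<close> counts the neighbors present.\<close>

definition vertex_bound :: "nat \<Rightarrow> nat \<Rightarrow> real" where
  "vertex_bound g k = (1 + cmod z) ^ k - 1 +
     path_sum (g - 2) * real (k choose 2) * \<beta> ^ \<Delta> * x * (1 + \<beta> ^ \<Delta> * x) ^ (k - 1)"

lemma A_empty: "A {} = Z"
  by (simp add: A_def Z_def)

lemma z_phi: "z * \<phi> B = z ^ card B * of_real (tree_weight E B)"
  using z_nonzero by (simp add: \<phi>_def)

lemma norm_z_phi: "cmod (z * \<phi> B) * (1 / (1 - a)) ^ card B = \<bar>wt B\<bar>"
proof -
  have "cmod z * (1 / (1 - a)) = x"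
    using x_eq a_bounds by (simp add: field_simps)
  then have "cmod z ^ card B * (1 / (1 - a)) ^ card B = x ^ card B"
    by (metis power_mult_distrib)
  then show ?thesis
    using x_nonneg by (simp add: z_phi norm_mult norm_power wt_def abs_mult mult_ac)
qed

text \<open>By the tree weight recursion, the block of \<open>u\<close> contributes a partition sum
  of \<open>z * \<phi> B\<close> over blocks meeting the neighbors of \<open>u\<close>. Convolution
  with \<open>Z\<close> adds this weight to \<open>\<phi> B\<close>.\<close>

lemma Z_insert:
  assumes "finite Y" "u \<notin> Y"
  shows "Z (insert u Y) = A (neighbors E u) Y"
proof -
  have "\<phi> (insert u W) = pexp (\<lambda>B. of_bool (B \<inter> neighbors E u \<noteq> {}) * (z * \<phi> B)) W"
    if "W \<subseteq> Y" for W
  proof -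
    have W: "finite W" "u \<notin> W"
      using that assms finite_subset by auto
    have "pexp (\<lambda>B. of_bool (B \<inter> neighbors E u \<noteq> {}) * (z * \<phi> B)) W
        = pexp (\<lambda>B. z ^ card B * of_real (of_bool (B \<inter> neighbors E u \<noteq> {}) * tree_weight E B)) W"
      by (rule pexp_cong) (simp add: z_phi)
    also have "\<dots> = z ^ card W * of_real (tree_weight E (insert u W))"
      by (simp only: pexp_scale[OF W(1)] pexp_of_real tree_weight_insert[OF W no_loop])
    also have "\<dots> = \<phi> (insert u W)"
      using W z_nonzero by (simp add: \<phi>_def)
    finally show ?thesis ..
  qed
  then show ?thesis
    unfolding Z_def A_def pexp_insert[OF assms] pexp_add[OF assms(1)]
    by (intro sum.cong refl arg_cong2[of _ _ _ _ "(*)"]) auto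
qed

text \<open>With \<open>n\<close> inserted, its block \<open>B\<close> weighs
  \<open>(1 + z) * \<phi> B\<close>. If \<open>B\<close> already met \<open>N\<close>, it had that
  weight before; the subtracted sum removes this excess.\<close>

lemma A_insert:
  assumes "finite Y" "n \<in> Y" "n \<notin> N"
  shows "A (insert n N) Y = (1 + z) *
    (A N Y - (\<Sum>B | B \<subseteq> Y \<and> n \<in> B. of_bool (B \<inter> N \<noteq> {}) * (z * \<phi> B) * A N (Y - B)))"
proof -
  let ?S = "{B. B \<subseteq> Y \<and> n \<in> B}"
  have cong: "A (insert n N) (Y - B) = A N (Y - B)" if "n \<in> B" for B
    unfolding A_def using that
    by (intro pexp_cong arg_cong2[of _ _ _ _ "(+)"] arg_cong2[of _ _ _ _ "(*)"]
        arg_cong[of _ _ of_bool] refl) auto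
  have "A (insert n N) Y
      = (\<Sum>B\<in>?S. (of_bool (B \<inter> insert n N \<noteq> {}) * (z * \<phi> B) + \<phi> B) * A (insert n N) (Y - B))"
    unfolding A_def by (rule pexp_rec[OF assms(1,2)])
  also have "\<dots> = (\<Sum>B\<in>?S. (1 + z) * (\<phi> B * A N (Y - B)))"
    by (intro sum.cong refl) (auto simp: cong algebra_simps)
  also have "\<dots> = (1 + z) * (\<Sum>B\<in>?S. \<phi> B * A N (Y - B))"
    by (rule sum_distrib_left[symmetric])
  also have "(\<Sum>B\<in>?S. \<phi> B * A N (Y - B))
      = A N Y - (\<Sum>B\<in>?S. of_bool (B \<inter> N \<noteq> {}) * (z * \<phi> B) * A N (Y - B))"
  proof -
    have "A N Y = (\<Sum>B\<in>?S. (of_bool (B \<inter> N \<noteq> {}) * (z * \<phi> B) + \<phi> B) * A N (Y - B))"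
      unfolding A_def by (rule pexp_rec[OF assms(1,2)])
    then show ?thesis
      by (simp add: distrib_right sum.distrib)
  qed
  finally show ?thesis .
qed

text \<open>As a convolution, \<open>A N W\<close> takes sets \<open>U\<close> out of
  \<open>W\<close>. The factor \<open>1 / (1 - a)\<close> for each vertex of \<open>U\<close> turns
  \<open>z * \<phi>\<close> into \<open>wt\<close>, and the sum over \<open>U\<close> becomes a
  product over \<open>N \<inter> W\<close>.\<close>

lemma norm_A_le:
  assumes "finite Y" "W \<subseteq> Y"
    and Z_le: "\<And>W. W \<subseteq> Y \<Longrightarrow> cmod (Z W) \<le> (1 / (1 - a)) ^ card (Y - W) * M"
    and "0 \<le> M"
  shows "cmod (A N W) \<le> (1 / (1 - a)) ^ card (Y - W) * M * (1 + \<beta> ^ \<Delta> * x) ^ card (N \<inter> W)"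
proof -
  let ?r = "1 / (1 - a)"
  let ?P = "pexp (\<lambda>B. of_bool (B \<inter> N \<noteq> {}) * wt B)"
  have r: "0 < ?r"
    using a_bounds by simp
  have finW: "finite W"
    using assms finite_subset by blast
  have wt_nonneg': "0 \<le> wt B" if "B \<subseteq> W" "B \<noteq> {}" for B
    using that finW by (intro wt_nonneg) (auto intro: finite_subset)
  have "cmod (A N W) \<le> (\<Sum>U\<in>Pow W. cmod (pexp (\<lambda>B. of_bool (B \<inter> N \<noteq> {}) * (z * \<phi> B)) U * Z (W - U)))"
    unfolding A_def Z_def pexp_add[OF finW] by (rule norm_sum)
  also have "\<dots> \<le> (\<Sum>U\<in>Pow W. ?r ^ card (Y - W) * M * ?P U)"
  proof (rule sum_mono)
    fix U assume "U \<in> Pow W"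
    then have U: "U \<subseteq> W" by simp
    have finU: "finite U" using U finW finite_subset by blast
    have "cmod (pexp (\<lambda>B. of_bool (B \<inter> N \<noteq> {}) * (z * \<phi> B)) U) * ?r ^ card U
        \<le> pexp (\<lambda>B. cmod (of_bool (B \<inter> N \<noteq> {}) * (z * \<phi> B))) U * ?r ^ card U"
      using r by (intro mult_right_mono norm_pexp_le) auto
    also have "\<dots> = pexp (\<lambda>B. ?r ^ card B * cmod (of_bool (B \<inter> N \<noteq> {}) * (z * \<phi> B))) U"
      by (simp add: pexp_scale[OF finU] mult.commute)
    also have "\<dots> = ?P U"
    proof (rule pexp_cong)
      fix B assume "B \<subseteq> U" "B \<noteq> {}"
      then have "wt B = cmod (z * \<phi> B) * ?r ^ card B"
        using wt_nonneg'[of B] U by (simp only: norm_z_phi) auto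
      then show "?r ^ card B * cmod (of_bool (B \<inter> N \<noteq> {}) * (z * \<phi> B)) = of_bool (B \<inter> N \<noteq> {}) * wt B"
        by simp
    qed
    finally have P: "cmod (pexp (\<lambda>B. of_bool (B \<inter> N \<noteq> {}) * (z * \<phi> B)) U) * ?r ^ card U \<le> ?P U" .
    have "Y - (W - U) = (Y - W) \<union> U"
      using U assms(2) by auto
    then have card_eq: "card (Y - (W - U)) = card U + card (Y - W)"
      using U finU assms(1) by (subst add.commute) (auto intro!: card_Un_disjoint)
    have "cmod (Z (W - U)) \<le> ?r ^ card (Y - (W - U)) * M"
      using assms(2) by (intro Z_le) auto
    then have "cmod (pexp (\<lambda>B. of_bool (B \<inter> N \<noteq> {}) * (z * \<phi> B)) U * Z (W - U))
        \<le> cmod (pexp (\<lambda>B. of_bool (B \<inter> N \<noteq> {}) * (z * \<phi> B)) U) * (?r ^ card (Y - (W - U)) * M)"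
      unfolding norm_mult by (intro mult_left_mono) auto
    also have "\<dots> = ?r ^ card (Y - W) * M *
        (cmod (pexp (\<lambda>B. of_bool (B \<inter> N \<noteq> {}) * (z * \<phi> B)) U) * ?r ^ card U)"
      unfolding card_eq power_add by (simp only: mult_ac)
    also have "\<dots> \<le> ?r ^ card (Y - W) * M * ?P U"
      using P r assms(4) by (intro mult_left_mono mult_nonneg_nonneg zero_le_power) auto
    finally show "cmod (pexp (\<lambda>B. of_bool (B \<inter> N \<noteq> {}) * (z * \<phi> B)) U * Z (W - U))
        \<le> ?r ^ card (Y - W) * M * ?P U" .
  qed
  also have "\<dots> = ?r ^ card (Y - W) * M * (\<Sum>U\<in>Pow W. ?P U)"
    by (rule sum_distrib_left[symmetric])
  also have "\<dots> \<le> ?r ^ card (Y - W) * M * (\<Prod>n\<in>N \<inter> W. 1 + rooted W n)"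
    using r assms(4) finW by (intro mult_left_mono sum_pexp_meeting_neighbors_le) auto
  also have "\<dots> \<le> ?r ^ card (Y - W) * M * (\<Prod>n\<in>N \<inter> W. 1 + \<beta> ^ \<Delta> * x)"
    using r assms(4) finW rooted_le[OF finW] rooted_nonneg[OF finW]
    by (intro mult_left_mono prod_mono conjI) (auto simp: mult.commute add_nonneg_nonneg)
  finally show ?thesis by simp
qed

lemma cmod_z_le: "cmod z \<le> \<beta> ^ \<Delta> * x"
proof -
  have "cmod z = x * (1 - a)"
    by (rule x_eq[symmetric])
  also have "\<dots> \<le> x * \<beta> ^ \<Delta>"
    using x_nonneg a_bounds one_le_power[OF beta_ge_1, of \<Delta>] by (intro mult_left_mono) linarith+
  finally show ?thesis by (simp add: mult.commute)
qed

text \<open>Elements enter \<open>N\<close> one by one. Each multiplies by \<open>1 + z\<close>, up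
  to an error from blocks that contain the new element and an earlier one; these pairs give the
  binomial coefficient.\<close>

lemma norm_A_minus_Z_le:
  assumes "finite Y" "N \<subseteq> Y"
    and Z_le: "\<And>W. W \<subseteq> Y \<Longrightarrow> cmod (Z W) \<le> (1 / (1 - a)) ^ card (Y - W) * cmod (Z Y)"
    and birooted: "\<And>m n. m \<in> N \<Longrightarrow> n \<in> N \<Longrightarrow> m \<noteq> n \<Longrightarrow> birooted Y n m \<le> x * \<beta> ^ \<Delta> * path_sum (g - 2)"
  shows "cmod (A N Y - Z Y) \<le> cmod (Z Y) * vertex_bound g (card N)"
proof -
  define M where "M = cmod (Z Y)"
  define y where "y = \<beta> ^ \<Delta> * x"
  define F where "F = path_sum (g - 2)"
  let ?r = "1 / (1 - a)"
  have r: "0 < ?r" using a_bounds by simp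
  have y: "cmod z \<le> y" "0 \<le> y"
    using cmod_z_le beta_ge_1 x_nonneg by (auto simp: y_def)
  have M: "0 \<le> M" by (simp add: M_def)
  have F: "0 \<le> F" by (simp add: F_def path_sum_nonneg)
  have "finite N"
    using assms(1,2) finite_subset by blast
  then have "cmod (A N Y - Z Y)
      \<le> M * ((1 + cmod z) ^ card N - 1 + F * real (card N choose 2) * y * (1 + y) ^ (card N - 1))"
    using assms(2) birooted
  proof (induction N rule: finite_induct)
    case empty
    then show ?case by (simp add: A_empty binomial_eq_0)
  next
    case (insert n N)
    define k where "k = card N"
    define S where "S = (\<Sum>B | B \<subseteq> Y \<and> n \<in> B. of_bool (B \<inter> N \<noteq> {}) * (z * \<phi> B) * A N (Y - B))"
    have n: "n \<in> Y" "n \<notin> N" "N \<subseteq> Y"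
      using insert by auto
    have fin: "finite {B. B \<subseteq> Y \<and> n \<in> B}"
      using assms(1) by (auto intro: finite_subset[of _ "Pow Y"])
    have wt_nonneg': "0 \<le> wt B" if "B \<subseteq> Y" "B \<noteq> {}" for B
      using that assms(1) by (intro wt_nonneg) (auto intro: finite_subset)
    have IH: "cmod (A N Y - Z Y) \<le> M * ((1 + cmod z) ^ k - 1 + F * real (k choose 2) * y * (1 + y) ^ (k - 1))"
      unfolding k_def using insert.prems n by (intro insert.IH) auto
    have S_le: "cmod S \<le> real k * (y * F) * (M * (1 + y) ^ (k - 1))"
    proof -
      have "cmod S \<le> (\<Sum>B | B \<subseteq> Y \<and> n \<in> B. cmod (of_bool (B \<inter> N \<noteq> {}) * (z * \<phi> B) * A N (Y - B)))"
        unfolding S_def by (rule norm_sum)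
      also have "\<dots> \<le> (\<Sum>B | B \<subseteq> Y \<and> n \<in> B. \<Sum>m\<in>N. of_bool (m \<in> B) * wt B * (M * (1 + y) ^ (k - 1)))"
      proof (rule sum_mono)
        fix B assume "B \<in> {B. B \<subseteq> Y \<and> n \<in> B}"
        then have B: "B \<subseteq> Y" "n \<in> B" by auto
        have wtB: "0 \<le> wt B"
          using B by (intro wt_nonneg') auto
        have term_nonneg: "0 \<le> of_bool (m \<in> B) * wt B * (M * (1 + y) ^ (k - 1))" for m
          using wtB M y by simp
        show "cmod (of_bool (B \<inter> N \<noteq> {}) * (z * \<phi> B) * A N (Y - B))
            \<le> (\<Sum>m\<in>N. of_bool (m \<in> B) * wt B * (M * (1 + y) ^ (k - 1)))"
        proof (cases "B \<inter> N = {}")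
          case True
          then show ?thesis
            using sum_nonneg[OF term_nonneg] by simp
        next
          case False
          then obtain m where m: "m \<in> B" "m \<in> N" by auto
          have "Y - (Y - B) = B"
            using B by auto
          then have "cmod (A N (Y - B)) \<le> ?r ^ card B * M * (1 + y) ^ card (N \<inter> (Y - B))"
            using norm_A_le[OF assms(1) _ Z_le, of "Y - B" N] by (simp add: M_def y_def)
          \<comment> \<open>The element \<open>m\<close> of \<open>N\<close> lies in
            \<open>B\<close>, so at most \<open>k - 1\<close> elements of \<open>N\<close> are
            left.\<close>
          also have "\<dots> \<le> ?r ^ card B * M * (1 + y) ^ (k - 1)"
          proof (intro mult_left_mono power_increasing)
            have "N \<inter> (Y - B) \<subseteq> N - {m}"
              using m by auto
            then have "card (N \<inter> (Y - B)) \<le> card (N - {m})"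
              using insert.hyps by (intro card_mono) auto
            then show "card (N \<inter> (Y - B)) \<le> k - 1"
              using m insert.hyps by (simp add: k_def)
          qed (use r M y in auto)
          finally have "cmod (z * \<phi> B) * cmod (A N (Y - B))
              \<le> cmod (z * \<phi> B) * (?r ^ card B * M * (1 + y) ^ (k - 1))"
            by (rule mult_left_mono) simp
          also have "\<dots> = wt B * (M * (1 + y) ^ (k - 1))"
            using norm_z_phi[of B] wtB by (simp only: mult.assoc[symmetric] abs_of_nonneg)
          also have "\<dots> = of_bool (m \<in> B) * wt B * (M * (1 + y) ^ (k - 1))"
            using m by simp
          also have "\<dots> \<le> (\<Sum>m\<in>N. of_bool (m \<in> B) * wt B * (M * (1 + y) ^ (k - 1)))"
            by (rule member_le_sum[OF m(2) term_nonneg insert.hyps(1)])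
          finally show ?thesis
            using False by (simp add: norm_mult)
        qed
      qed
      also have "\<dots> = (\<Sum>m\<in>N. \<Sum>B | B \<subseteq> Y \<and> n \<in> B. of_bool (m \<in> B) * wt B) * (M * (1 + y) ^ (k - 1))"
        by (subst sum.swap) (simp add: sum_distrib_right)
      also have "(\<Sum>m\<in>N. \<Sum>B | B \<subseteq> Y \<and> n \<in> B. of_bool (m \<in> B) * wt B) = (\<Sum>m\<in>N. birooted Y n m)"
        unfolding birooted_def using fin
        by (intro sum.cong refl sum.mono_neutral_cong_right) auto
      also have "(\<Sum>m\<in>N. birooted Y n m) * (M * (1 + y) ^ (k - 1))
          \<le> (\<Sum>m\<in>N. y * F) * (M * (1 + y) ^ (k - 1))"
      proof (intro mult_right_mono sum_mono)
        fix m assume "m \<in> N"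
        then show "birooted Y n m \<le> y * F"
          using insert.prems(2)[of m n] n by (auto simp: y_def F_def mult_ac)
      qed (use M y in auto)
      finally show ?thesis by (simp add: k_def)
    qed
    have "A (insert n N) Y - Z Y = (1 + z) * (A N Y - Z Y) + z * Z Y - (1 + z) * S"
      using A_insert[OF assms(1) n(1,2)] by (simp add: S_def algebra_simps)
    then have "cmod (A (insert n N) Y - Z Y)
        \<le> cmod (1 + z) * cmod (A N Y - Z Y) + cmod z * M + cmod (1 + z) * cmod S"
      using norm_triangle_ineq4[of "(1 + z) * (A N Y - Z Y) + z * Z Y" "(1 + z) * S"]
        norm_triangle_ineq[of "(1 + z) * (A N Y - Z Y)" "z * Z Y"]
      by (simp add: norm_mult M_def)
    also have "\<dots> \<le> (1 + cmod z) * (M * ((1 + cmod z) ^ k - 1 + F * real (k choose 2) * y * (1 + y) ^ (k - 1)))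
        + cmod z * M + (1 + cmod z) * (real k * (y * F) * (M * (1 + y) ^ (k - 1)))"
      using IH S_le norm_triangle_ineq[of 1 z] M
      by (intro add_mono mult_mono) auto
    \<comment> \<open>Pascal's rule: the \<open>k\<close> new pairs raise \<open>k choose 2\<close>
      to \<open>Suc k choose 2\<close>.\<close>
    also have "\<dots> = M * ((1 + cmod z) ^ Suc k - 1
        + F * real (Suc k choose 2) * y * ((1 + cmod z) * (1 + y) ^ (k - 1)))"
      by (simp add: algebra_simps numeral_2_eq_2)
    \<comment> \<open>Since \<open>cmod z \<le> y\<close>, the factor \<open>1 + cmod z\<close> is
      absorbed into the power. For \<open>k = 0\<close> the binomial coefficient vanishes.\<close>
    also have "\<dots> \<le> M * ((1 + cmod z) ^ Suc k - 1 + F * real (Suc k choose 2) * y * (1 + y) ^ k)"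
    proof (cases k)
      case 0
      then show ?thesis by (simp add: numeral_2_eq_2)
    next
      case (Suc j)
      have "(1 + cmod z) * (1 + y) ^ (k - 1) \<le> (1 + y) * (1 + y) ^ (k - 1)"
        using y by (intro mult_right_mono) auto
      also have "\<dots> = (1 + y) ^ k"
        using Suc by simp
      finally show ?thesis
        using F y M by (intro mult_left_mono add_left_mono) auto
    qed
    finally show ?case
      using insert.hyps by (simp add: k_def)
  qed
  then show ?thesis
    by (simp add: M_def F_def y_def vertex_bound_def mult_ac)
qed

lemma vertex_bound_mono:
  assumes "k \<le> \<Delta>"
  shows "vertex_bound g k \<le> vertex_bound g \<Delta>"
proof -
  have y: "0 \<le> \<beta> ^ \<Delta> * x"
    using beta_ge_1 x_nonneg by simp
  have "real (k choose 2) \<le> real (\<Delta> choose 2)"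
    using assms by (simp add: choose_two div_le_mono mult_le_mono)
  then show ?thesis
    unfolding vertex_bound_def using assms y path_sum_nonneg[of "g - 2"] beta_ge_1 x_nonneg
    by (intro add_mono diff_mono mult_mono power_increasing) auto
qed

lemma Z_insert_ge:
  assumes "finite Y" "u \<notin> Y" "vertex_bound g \<Delta> \<le> a"
    and Z_le: "\<And>W. W \<subseteq> Y \<Longrightarrow> cmod (Z W) \<le> (1 / (1 - a)) ^ card (Y - W) * cmod (Z Y)"
    and birooted: "\<And>m n. m \<in> neighbors E u \<inter> Y \<Longrightarrow> n \<in> neighbors E u \<inter> Y \<Longrightarrow> m \<noteq> n
      \<Longrightarrow> birooted Y n m \<le> x * \<beta> ^ \<Delta> * path_sum (g - 2)"
  shows "(1 - a) * cmod (Z Y) \<le> cmod (Z (insert u Y))"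
proof -
  let ?N = "neighbors E u \<inter> Y"
  have "A (neighbors E u) Y = A ?N Y"
    unfolding A_def
    by (intro pexp_cong arg_cong2[of _ _ _ _ "(+)"] arg_cong2[of _ _ _ _ "(*)"]
        arg_cong[of _ _ of_bool] refl) auto
  then have "cmod (Z (insert u Y) - Z Y) \<le> cmod (Z Y) * vertex_bound g (card ?N)"
    using norm_A_minus_Z_le[OF assms(1) _ Z_le birooted, of ?N] assms(1,2)
    by (simp add: Z_insert)
  also have "\<dots> \<le> cmod (Z Y) * a"
    using vertex_bound_mono[OF card_neighbors_Int_le[of u Y], of g] assms(3)
    by (intro mult_left_mono) auto
  finally show ?thesis
    using norm_triangle_ineq2[of "Z Y" "Z (insert u Y)"]
    by (simp add: norm_minus_commute algebra_simps)
qed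

text \<open>Both claims are proved together: removing one vertex needs the ratio bounds for all
  subsets of the rest. Removing vertices in turn gives the power, and \<open>a < 1\<close> keeps
  \<open>Z\<close> away from zero.\<close>

lemma Z_ratio:
  assumes "finite X" "vertex_bound g \<Delta> \<le> a"
    and birooted: "\<And>Y u m n. finite Y \<Longrightarrow> u \<notin> Y \<Longrightarrow> m \<in> neighbors E u \<inter> Y \<Longrightarrow> n \<in> neighbors E u \<inter> Y
      \<Longrightarrow> m \<noteq> n \<Longrightarrow> birooted Y n m \<le> x * \<beta> ^ \<Delta> * path_sum (g - 2)"
  shows "Z X \<noteq> 0 \<and> (\<forall>W\<subseteq>X. cmod (Z W) \<le> (1 / (1 - a)) ^ card (X - W) * cmod (Z X))"
  using assms(1)
proof (induction X rule: finite_psubset_induct)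
  case (psubset X)
  have r: "0 < 1 / (1 - a)"
    using a_bounds by simp
  have step: "Z (X - {u}) \<noteq> 0 \<and> (1 - a) * cmod (Z (X - {u})) \<le> cmod (Z X)
      \<and> (\<forall>W\<subseteq>X - {u}. cmod (Z W) \<le> (1 / (1 - a)) ^ card (X - {u} - W) * cmod (Z (X - {u})))"
    if "u \<in> X" for u
  proof -
    have IH: "Z (X - {u}) \<noteq> 0"
      "\<forall>W\<subseteq>X - {u}. cmod (Z W) \<le> (1 / (1 - a)) ^ card (X - {u} - W) * cmod (Z (X - {u}))"
      using psubset.IH[of "X - {u}"] that by auto
    have "(1 - a) * cmod (Z (X - {u})) \<le> cmod (Z (insert u (X - {u})))"
      using psubset.hyps IH(2) by (intro Z_insert_ge[OF _ _ assms(2)] birooted) auto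
    then show ?thesis
      using IH that by (simp add: insert_absorb)
  qed
  show ?case
  proof (intro conjI allI impI)
    show "Z X \<noteq> 0"
    proof (cases "X = {}")
      case True
      then show ?thesis by (simp add: Z_def)
    next
      case False
      then obtain u where "u \<in> X" by auto
      from step[OF this] have "0 < (1 - a) * cmod (Z (X - {u}))" "(1 - a) * cmod (Z (X - {u})) \<le> cmod (Z X)"
        using a_bounds by auto
      then show ?thesis by auto
    qed
    fix W assume W: "W \<subseteq> X"
    show "cmod (Z W) \<le> (1 / (1 - a)) ^ card (X - W) * cmod (Z X)"
    proof (cases "W = X")
      case False
      then obtain u where u: "u \<in> X" "u \<notin> W"
        using W by auto
      then have "X - W = insert u (X - {u} - W)"
        by auto
      then have card_eq: "card (X - W) = Suc (card (X - {u} - W))"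
        using psubset.hyps by simp
      have "cmod (Z W) \<le> (1 / (1 - a)) ^ card (X - {u} - W) * cmod (Z (X - {u}))"
        using step[OF u(1)] W u(2) by auto
      also have "\<dots> \<le> (1 / (1 - a)) ^ card (X - {u} - W) * (1 / (1 - a) * cmod (Z X))"
        using step[OF u(1)] r a_bounds by (intro mult_left_mono) (auto simp: field_simps)
      finally show ?thesis
        by (simp add: card_eq mult_ac)
    qed simp
  qed
qed

end

subsection \<open>Girth, degrees and the constant\<close>

text \<open>A path between two neighbors of \<open>u\<close> that avoids \<open>u\<close> closes up
  through \<open>u\<close>. Girth \<open>g\<close> thus forces at least \<open>g - 1\<close>
  vertices, that is \<open>g - 2\<close> edges, on the path.\<close>

lemma cycle_from_path:
  assumes "path_between E Y s t p" "u \<notin> Y" "{u, s} \<in> E" "{t, u} \<in> E" "s \<noteq> t"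
  shows "is_cycle E (u # p)"
proof -
  have p: "p \<noteq> []" "hd p = s" "last p = t" "distinct p" "set p \<subseteq> Y"
    and succ: "\<And>i. Suc i < length p \<Longrightarrow> {p ! i, p ! Suc i} \<in> E"
    using assms(1) by (auto simp: path_between_def successively_conv_nth)
  have len: "2 \<le> length p"
    using p(1-3) assms(5) by (cases p rule: remdups_adj.cases) auto
  have "{(u # p) ! i, (u # p) ! (Suc i mod length (u # p))} \<in> E" if "i < length (u # p)" for i
  proof -
    consider "i = 0" | j where "i = Suc j" "Suc j < length p" | "i = length p"
      using \<open>i < length (u # p)\<close> by (cases i) (auto simp: less_Suc_eq)
    then show ?thesis
    proof cases
      case 1
      then show ?thesis
        using p len assms(3) by (simp add: hd_conv_nth)
    next
      case 2
      then show ?thesis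
        using succ by simp
    next
      case 3
      then show ?thesis
        using p len assms(4) by (simp add: last_conv_nth nth_Cons')
    qed
  qed
  then show ?thesis
    using p assms(2) len by (auto simp: is_cycle_def)
qed

lemma girth_le_length: "is_cycle E c \<Longrightarrow> girth E \<le> enat (length c)"
  unfolding girth_def by (rule INF_lower) simp

text \<open>Sending \<open>w\<close> to the edge \<open>{v, w}\<close> is injective. A vertex
  outside \<open>V\<close>, over which \<open>max_degree\<close> does not range, has no
  neighbors.\<close>

lemma
  assumes "finite_simple_graph V E" "max_degree V E = \<Delta>"
  shows finite_neighbors: "finite (neighbors E v)"
    and card_neighbors_le: "card (neighbors E v) \<le> \<Delta>"
proof -
  have fin: "finite V" and edges: "\<And>e. e \<in> E \<Longrightarrow> e \<subseteq> V \<and> card e = 2"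
    using assms(1) by (auto simp: finite_simple_graph_def)
  have sub: "neighbors E v \<subseteq> V"
    using edges by (auto simp: neighbors_def)
  then show fin_nb: "finite (neighbors E v)"
    using fin finite_subset by blast
  show "card (neighbors E v) \<le> \<Delta>"
  proof (cases "v \<in> V")
    case True
    have "finite E"
      using edges fin by (auto intro: finite_subset[of _ "Pow V"])
    then have "card (neighbors E v) \<le> card {e \<in> E. v \<in> e}"
      by (intro card_inj_on_le[where f = "\<lambda>w. {v, w}"])
        (auto simp: inj_on_def neighbors_def doubleton_eq_iff)
    also have "\<dots> \<le> Max (degree_in E ` V)"
      using True fin unfolding degree_in_def[symmetric] by (intro Max_ge) auto
    finally show ?thesis
      using assms(2) by (simp add: max_degree_def)
  next
    case False
    then have "neighbors E v = {}"
      using edges by (auto simp: neighbors_def)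
    then show ?thesis by simp
  qed
qed

section \<open>The substitution of \<open>b powr (1 / \<Delta>)\<close> for \<open>b\<close>, and
  the monotonicity of \<open>x_fun\<close>\<close>

context
  fixes \<Delta> :: nat
  assumes Delta: "3 \<le> \<Delta>"
begin

lemma root_facts:
  assumes "1 \<le> b"
  shows "1 \<le> b powr (1 / real \<Delta>)" "(b powr (1 / real \<Delta>)) ^ \<Delta> = b"
    "b powr (- 1 / real \<Delta>) = 1 / b powr (1 / real \<Delta>)"
    "x_fun \<Delta> b = (b powr (1 / real \<Delta>) - 1) / (b powr (1 / real \<Delta>)) ^ (\<Delta> - 1)"
proof -
  let ?\<beta> = "b powr (1 / real \<Delta>)"
  show "1 \<le> ?\<beta>"
    using assms by (simp add: ge_one_powr_ge_zero)
  then have pos: "0 < ?\<beta>" by linarith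
  show b: "?\<beta> ^ \<Delta> = b"
    using assms Delta by (simp add: powr_realpow[symmetric] powr_powr)
  show "b powr (- 1 / real \<Delta>) = 1 / ?\<beta>"
    by (simp add: powr_minus_divide)
  have "b powr (2 / real \<Delta>) = ?\<beta> * ?\<beta>"
    by (simp flip: powr_add)
  moreover have "b = ?\<beta> * ?\<beta> ^ (\<Delta> - 1)"
    using Delta b by (simp flip: power_Suc)
  ultimately have "x_fun \<Delta> b = (?\<beta> * ?\<beta> - ?\<beta>) / (?\<beta> * ?\<beta> ^ (\<Delta> - 1))"
    unfolding x_fun_def by metis
  also have "\<dots> = (?\<beta> - 1) / ?\<beta> ^ (\<Delta> - 1)"
    using pos by (simp add: field_simps)
  finally show "x_fun \<Delta> b = (?\<beta> - 1) / ?\<beta> ^ (\<Delta> - 1)" .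
qed

lemma rho_gt_1: "1 < rho \<Delta>"
  unfolding rho_def using Delta by (intro one_less_power) (auto simp: field_simps)

lemma rho_root: "rho \<Delta> powr (1 / real \<Delta>) = (real \<Delta> - 1) / (real \<Delta> - 2)"
  unfolding rho_def using Delta
  by (simp add: powr_realpow[symmetric] powr_powr)

lemma root_less_iff:
  assumes "1 \<le> b"
  shows "b < rho \<Delta> \<longleftrightarrow> b powr (1 / real \<Delta>) < (real \<Delta> - 1) / (real \<Delta> - 2)"
proof
  assume "b < rho \<Delta>"
  then show "b powr (1 / real \<Delta>) < (real \<Delta> - 1) / (real \<Delta> - 2)"
    unfolding rho_root[symmetric] using assms Delta by (intro powr_less_mono2) auto
next
  assume *: "b powr (1 / real \<Delta>) < (real \<Delta> - 1) / (real \<Delta> - 2)"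
  show "b < rho \<Delta>"
  proof (rule ccontr)
    assume "\<not> b < rho \<Delta>"
    then have "rho \<Delta> powr (1 / real \<Delta>) \<le> b powr (1 / real \<Delta>)"
      using rho_gt_1 Delta by (intro powr_mono2) auto
    with * show False
      unfolding rho_root by simp
  qed
qed

lemma x_fun_nonneg: "1 \<le> b \<Longrightarrow> 0 \<le> x_fun \<Delta> b"
  using root_facts(1)[of b] by (simp add: root_facts(4))

lemma x_fun_1: "x_fun \<Delta> 1 = 0"
  by (simp add: x_fun_def)

text \<open>The function \<open>(\<beta> - 1) / \<beta> ^ (\<Delta> - 1)\<close> increases up to
  \<open>\<beta> = (\<Delta> - 1) / (\<Delta> - 2)\<close>, the root of \<open>rho \<Delta>\<close>.
  Bernoulli's inequality, applied to \<open>(\<beta> / \<beta>') ^ (\<Delta> - 1)\<close>, replaces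
  differentiation.\<close>

lemma x_fun_mono:
  assumes "1 \<le> b" "b \<le> b'" "b' < rho \<Delta>"
  shows "x_fun \<Delta> b \<le> x_fun \<Delta> b'"
proof (cases "b = 1")
  case True
  then show ?thesis
    using x_fun_1 x_fun_nonneg[of b'] assms by simp
next
  case False
  define \<beta> \<beta>' where "\<beta> = b powr (1 / real \<Delta>)" and "\<beta>' = b' powr (1 / real \<Delta>)"
  have le: "\<beta> \<le> \<beta>'"
    unfolding \<beta>_def \<beta>'_def using assms by (intro powr_mono2) auto
  have "1 < \<beta>"
    unfolding \<beta>_def using assms(1) False Delta by (intro gr_one_powr) auto
  then have gt: "1 < \<beta>'" "0 < \<beta>" "0 < \<beta>'"
    using le by auto
  have "\<beta>' < (real \<Delta> - 1) / (real \<Delta> - 2)"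
    unfolding \<beta>'_def using assms root_less_iff[of b'] by simp
  then have "real (\<Delta> - 1) * (\<beta>' - 1) \<le> \<beta>'"
    using Delta by (simp add: field_simps of_nat_diff)
  then have slope: "real (\<Delta> - 1) / \<beta>' \<le> 1 / (\<beta>' - 1)"
    using gt by (simp add: field_simps)
  have "(\<beta> - 1) / (\<beta>' - 1) = 1 - 1 / (\<beta>' - 1) * (\<beta>' - \<beta>)"
    using gt by (simp add: field_simps)
  also have "\<dots> \<le> 1 - real (\<Delta> - 1) / \<beta>' * (\<beta>' - \<beta>)"
    using mult_right_mono[OF slope, of "\<beta>' - \<beta>"] le by linarith
  also have "\<dots> = 1 + real (\<Delta> - 1) * (\<beta> / \<beta>' - 1)"
    using gt by (simp add: field_simps)
  also have "\<dots> \<le> (1 + (\<beta> / \<beta>' - 1)) ^ (\<Delta> - 1)"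
    using gt by (intro Bernoulli_inequality) auto
  also have "\<dots> = \<beta> ^ (\<Delta> - 1) / \<beta>' ^ (\<Delta> - 1)"
    by (simp add: power_divide)
  finally have "(\<beta> - 1) / \<beta> ^ (\<Delta> - 1) \<le> (\<beta>' - 1) / \<beta>' ^ (\<Delta> - 1)"
    using gt by (simp add: field_simps)
  then show ?thesis
    using assms by (simp add: root_facts(4) \<beta>_def \<beta>'_def)
qed

text \<open>\<open>1 - (\<Delta> - 1) (1 - b powr (- 1 / \<Delta>))\<close>, the denominator in \<^const>\<open>f_fun\<close>, vanishes at
  \<^term>\<open>rho \<Delta>\<close>. Multiplying \<open>K_fun \<Delta> g a b \<le> a\<close> by it gives an inequality between functions that are
  continuous up to and including \<^term>\<open>rho \<Delta>\<close>, where it fails.\<close>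

definition denom :: "real \<Rightarrow> real" where
  "denom b = 1 - (real \<Delta> - 1) * (1 - b powr (- 1 / real \<Delta>))"

definition numer :: "nat \<Rightarrow> real \<Rightarrow> real" where
  "numer g b = 1 / (real \<Delta> - 1) * ((real \<Delta> - 1) * (1 - b powr (- 1 / real \<Delta>))) ^ (g - 2)
     * real (\<Delta> choose 2) * b * x_fun \<Delta> b * (1 + b * x_fun \<Delta> b) ^ (\<Delta> - 1)"

definition cleared :: "nat \<Rightarrow> real \<Rightarrow> real \<Rightarrow> real" where
  "cleared g a b = ((1 + (1 - a) * x_fun \<Delta> b) ^ \<Delta> - 1 - a) * denom b + numer g b"

lemma denom_pos_iff:
  assumes "1 \<le> b"
  shows "0 < denom b \<longleftrightarrow> b < rho \<Delta>"
proof -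
  define \<beta> where "\<beta> = b powr (1 / real \<Delta>)"
  have "1 \<le> \<beta>"
    using root_facts(1)[OF assms] by (simp add: \<beta>_def)
  then have "0 < denom b \<longleftrightarrow> \<beta> < (real \<Delta> - 1) / (real \<Delta> - 2)"
    unfolding denom_def root_facts(3)[OF assms] \<beta>_def[symmetric] using Delta
    by (simp add: field_simps)
  then show ?thesis
    using root_less_iff[OF assms] by (simp add: \<beta>_def)
qed

lemma denom_rho: "denom (rho \<Delta>) = 0"
  unfolding denom_def root_facts(3)[OF less_imp_le[OF rho_gt_1]] rho_root
  using Delta by (simp add: field_simps)

lemma cleared_le_0_iff:
  assumes "1 \<le> b" "b < rho \<Delta>"
  shows "cleared g a b \<le> 0 \<longleftrightarrow> K_fun \<Delta> g a b \<le> a"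
proof -
  have pos: "0 < denom b"
    using denom_pos_iff assms by simp
  have "K_fun \<Delta> g a b - a = ((1 + (1 - a) * x_fun \<Delta> b) ^ \<Delta> - 1 - a) + numer g b / denom b"
    by (simp add: K_fun_def f_fun_def numer_def denom_def)
  also have "\<dots> = cleared g a b / denom b"
    using pos by (simp add: cleared_def add_divide_distrib)
  finally have "K_fun \<Delta> g a b \<le> a \<longleftrightarrow> cleared g a b / denom b \<le> 0"
    by linarith
  then show ?thesis
    using pos by (simp add: divide_le_0_iff)
qed

lemma cleared_rho_pos: "0 < cleared g a (rho \<Delta>)"
proof -
  have gt: "1 < rho \<Delta> powr (1 / real \<Delta>)"
    unfolding rho_root using Delta by simp
  have "0 < x_fun \<Delta> (rho \<Delta>)"
    using gt rho_gt_1 by (simp add: root_facts(4))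
  moreover have "0 < 1 - rho \<Delta> powr (- 1 / real \<Delta>)"
    using gt rho_gt_1 unfolding root_facts(3)[OF less_imp_le[OF rho_gt_1]] by simp
  ultimately have "0 < numer g (rho \<Delta>)"
    using Delta rho_gt_1 unfolding numer_def
    by (intro mult_pos_pos zero_less_power add_pos_pos) (auto simp: zero_less_binomial_iff)
  then show ?thesis
    by (simp add: cleared_def denom_rho)
qed

lemma continuous_on_x_fun: "continuous_on {1..} (x_fun \<Delta>)"
  unfolding x_fun_def by (intro continuous_intros) auto

lemma continuous_on_cleared:
  "continuous_on ({0..1} \<times> {1..rho \<Delta>}) (\<lambda>(a, b). cleared g a b)"
proof -
  have "continuous_on ({0..1} \<times> {1..rho \<Delta>}) (\<lambda>p. x_fun \<Delta> (snd p))"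
    by (rule continuous_on_compose2[OF continuous_on_x_fun]) (auto intro: continuous_intros)
  then show ?thesis
    unfolding cleared_def numer_def denom_def split_beta by (intro continuous_intros) auto
qed

section \<open>Compactness of the admissible pairs and the attained maximum\<close>

definition admissible :: "nat \<Rightarrow> (real \<times> real) set" where
  "admissible g = {(a, b). a \<in> {0..1} \<and> b \<in> {1..<rho \<Delta>} \<and> K_fun \<Delta> g a b \<le> a}"

text \<open>As \<open>cleared\<close> is positive at \<open>rho \<Delta>\<close>, the end point may
  be included, which exhibits a closed subset of a rectangle.\<close>

lemma admissible_eq:
  "admissible g = ({0..1} \<times> {1..rho \<Delta>}) \<inter> (\<lambda>(a, b). cleared g a b) -` {..0}"
proof -
  have "b < rho \<Delta>" if "cleared g a b \<le> 0" "b \<le> rho \<Delta>" for a b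
    using that cleared_rho_pos[of g a] by (cases "b = rho \<Delta>") auto
  then have "(b \<in> {1..<rho \<Delta>} \<and> K_fun \<Delta> g a b \<le> a) \<longleftrightarrow> (b \<in> {1..rho \<Delta>} \<and> cleared g a b \<le> 0)" for a b
    using cleared_le_0_iff[of b g a] by (cases "b < rho \<Delta>") auto
  then show ?thesis
    unfolding admissible_def set_eq_iff by simp
qed

lemma admissible_subset: "admissible g \<subseteq> {0..1} \<times> {1..rho \<Delta>}"
  unfolding admissible_eq by (rule inf_le1)

lemma compact_admissible: "compact (admissible g)"
proof -
  have K: "compact ({0..1::real} \<times> {1..rho \<Delta>})"
    by (intro compact_Times compact_Icc)
  have "closed (admissible g)"
    unfolding admissible_eq
    by (rule continuous_closed_preimage[OF continuous_on_cleared compact_imp_closed[OF K]]) simp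
  then show ?thesis
    using closed_Int_compact[OF _ K] by (metis admissible_subset inf.absorb1)
qed

text \<open>The section at \<open>a\<close> is compact and contains 1, because
  \<open>K_fun \<Delta> g a 1 = 0\<close>; so its supremum belongs to it.\<close>

lemma b_fun_admissible:
  assumes "a \<in> {0..1}"
  shows "(a, b_fun \<Delta> g a) \<in> admissible g"
    and "(a, b) \<in> admissible g \<Longrightarrow> b \<le> b_fun \<Delta> g a"
proof -
  define B where "B = {b \<in> {1..<rho \<Delta>}. K_fun \<Delta> g a b \<le> a}"
  have B: "b \<in> B \<longleftrightarrow> (a, b) \<in> admissible g" for b
    using assms by (auto simp: B_def admissible_def)
  have "B = snd ` (admissible g \<inter> {a} \<times> UNIV)"
    unfolding set_eq_iff B by (auto simp: image_iff Bex_def)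
  moreover have "compact (admissible g \<inter> {a} \<times> UNIV)"
    by (intro compact_Int_closed compact_admissible closed_Times) auto
  ultimately have "compact B"
    by (auto intro!: compact_continuous_image continuous_intros)
  moreover have "1 \<in> B"
    using assms rho_gt_1 Delta by (auto simp: B_def K_fun_def x_fun_1)
  moreover from \<open>compact B\<close> have bdd: "bdd_above B"
    by (intro bounded_imp_bdd_above compact_imp_bounded)
  ultimately have "Sup B \<in> B"
    by (intro closed_contains_Sup compact_imp_closed) auto
  moreover have Sup: "b_fun \<Delta> g a = Sup B"
    by (simp only: b_fun_def B_def)
  ultimately show "(a, b_fun \<Delta> g a) \<in> admissible g"
    using B by simp
  show "b \<le> b_fun \<Delta> g a" if "(a, b) \<in> admissible g"
    unfolding Sup using that B bdd by (intro cSup_upper) auto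
qed

text \<open>A maximizing pair exists by compactness. Raising its second entry to
  \<open>b_fun \<Delta> g a\<close> loses nothing, since \<open>x_fun\<close> increases, so the
  maximum is a value of \<open>z_fun\<close>.\<close>

lemma C_const_attained:
  obtains a b where "0 \<le> a" "a < 1" "1 < b" "b < rho \<Delta>" "K_fun \<Delta> g a b \<le> a" "0 < (1 - a) * x_fun \<Delta> b"
    "C_const \<Delta> g = inverse ((1 - a) * x_fun \<Delta> b)"
proof -
  let ?f = "\<lambda>(a, b). (1 - a) * x_fun \<Delta> b"
  have "continuous_on (admissible g) (\<lambda>p. x_fun \<Delta> (snd p))"
    by (rule continuous_on_compose2[OF continuous_on_x_fun])
      (auto simp: admissible_def intro: continuous_intros)
  then have "continuous_on (admissible g) ?f"
    unfolding split_beta by (intro continuous_intros)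
  moreover have "admissible g \<noteq> {}"
    using b_fun_admissible(1)[of 0] by auto
  ultimately obtain p where p: "p \<in> admissible g" "\<And>p'. p' \<in> admissible g \<Longrightarrow> ?f p' \<le> ?f p"
    using continuous_attains_sup[OF compact_admissible] by metis
  obtain a b0 where ab0: "p = (a, b0)" by (cases p)
  define b where "b = b_fun \<Delta> g a"
  have a: "a \<in> {0..1}" and b0: "1 \<le> b0"
    using p(1) by (auto simp: ab0 admissible_def)
  have b: "(a, b) \<in> admissible g" "b0 \<le> b"
    using b_fun_admissible[OF a] p(1) by (auto simp: b_def ab0)
  then have b_bounds: "1 \<le> b" "b < rho \<Delta>" "K_fun \<Delta> g a b \<le> a"
    by (auto simp: admissible_def)
  have "(1 - a) * x_fun \<Delta> b0 \<le> (1 - a) * x_fun \<Delta> b"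
    using a b(2) b0 b_bounds by (intro mult_left_mono x_fun_mono) auto
  then have max: "?f p' \<le> (1 - a) * x_fun \<Delta> b" if "p' \<in> admissible g" for p'
    using p(2)[OF that] by (simp add: ab0)
  have "(GREATEST z. z \<in> z_fun \<Delta> g ` {0..1}) = (1 - a) * x_fun \<Delta> b"
  proof (rule Greatest_equality)
    show "(1 - a) * x_fun \<Delta> b \<in> z_fun \<Delta> g ` {0..1}"
      using a by (auto simp: z_fun_def b_def)
    fix y assume "y \<in> z_fun \<Delta> g ` {0..1}"
    then obtain a' where "a' \<in> {0..1}" "y = (1 - a') * x_fun \<Delta> (b_fun \<Delta> g a')"
      by (auto simp: z_fun_def)
    then show "y \<le> (1 - a) * x_fun \<Delta> b"
      using max[OF b_fun_admissible(1)] by auto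
  qed
  then have C: "C_const \<Delta> g = inverse ((1 - a) * x_fun \<Delta> b)"
    by (simp add: C_const_def)
  \<comment> \<open>For a positive maximum some pair with \<open>a < 1 < b\<close> is needed:
    \<open>cleared g (1 / 2) 1 = - 1 / 2\<close> stays negative slightly above 1.\<close>
  have "\<exists>b'. 1 < b' \<and> (1 / 2, b') \<in> admissible g"
  proof -
    have cont: "continuous_on {1..rho \<Delta>} (cleared g (1 / 2))"
    proof -
      have "continuous_on {1..rho \<Delta>} (\<lambda>b. (1 / 2 :: real, b))"
        by (intro continuous_intros)
      moreover have "(\<lambda>b. (1 / 2 :: real, b)) ` {1..rho \<Delta>} \<subseteq> {0..1} \<times> {1..rho \<Delta>}"
        by auto
      ultimately show ?thesis
        using continuous_on_compose2[OF continuous_on_cleared, of "{1..rho \<Delta>}" "\<lambda>b. (1 / 2, b)" g]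
        by simp
    qed
    have "cleared g (1 / 2) 1 < 0"
      by (simp add: cleared_def numer_def denom_def x_fun_1)
    then have "\<forall>\<^sub>F b in at 1 within {1..rho \<Delta>}. cleared g (1 / 2) b < 0"
      using cont rho_gt_1 by (intro order_tendstoD(2)[where y = "cleared g (1 / 2) 1"])
        (auto simp: continuous_on)
    moreover have "at 1 within {1..rho \<Delta>} = at_right 1"
      using rho_gt_1 by (rule at_within_Icc_at_right)
    ultimately have "\<forall>\<^sub>F b in at_right 1. cleared g (1 / 2) b < 0"
      by simp
    moreover have "\<forall>\<^sub>F b in at_right 1. b \<in> {1<..<rho \<Delta>}"
      using rho_gt_1 by (rule eventually_at_right_real)
    ultimately have "\<forall>\<^sub>F b in at_right (1::real). cleared g (1 / 2) b < 0 \<and> b \<in> {1<..<rho \<Delta>}"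
      by (rule eventually_conj)
    then obtain b' where "cleared g (1 / 2) b' < 0" "b' \<in> {1<..<rho \<Delta>}"
      using eventually_happens trivial_limit_at_right_real by blast
    then show ?thesis
      by (intro exI[of _ b']) (auto simp: admissible_eq)
  qed
  then obtain b' where b': "1 < b'" "(1 / 2, b') \<in> admissible g" by auto
  have "1 < b' powr (1 / real \<Delta>)"
    using b'(1) Delta by (intro gr_one_powr) auto
  then have "0 < x_fun \<Delta> b'"
    using b'(1) by (simp add: root_facts(4))
  then have pos: "0 < (1 - a) * x_fun \<Delta> b"
    using max[OF b'(2)] by simp
  then have "a < 1" "b \<noteq> 1"
    using a x_fun_1 by (auto simp: zero_less_mult_iff)
  with a b_bounds pos C show thesis
    by (intro that[of a b]) auto
qed

end

section \<open>From the ratio bounds to the chromatic polynomial\<close>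

theorem theorem1p1:
  fixes V :: "'a set" and E :: "'a set set" and \<Delta> g :: nat and q :: complex
  assumes "finite_simple_graph V E"
    and "max_degree V E = \<Delta>" and "\<Delta> \<ge> 3"
    and "girth E = enat g" and "g \<ge> 3"
    and "cmod q \<ge> C_const \<Delta> g"
  shows "poly (chromatic_poly V E) q \<noteq> 0"
proof -
  obtain a b where ab: "0 \<le> a" "a < 1" "1 < b" "b < rho \<Delta>" "K_fun \<Delta> g a b \<le> a"
    and pos: "0 < (1 - a) * x_fun \<Delta> b"
    and C: "C_const \<Delta> g = inverse ((1 - a) * x_fun \<Delta> b)"
    using C_const_attained[OF assms(3)] by metis
  define \<beta> where "\<beta> = b powr (1 / real \<Delta>)"
  define z where "z = - 1 / q"
  \<comment> \<open>This choice makes \<open>x_eq\<close> exact for the given \<open>q\<close>; the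
    hypothesis on \<open>cmod q\<close> yields \<open>x \<le> x_fun \<Delta> b\<close>.\<close>
  define x where "x = cmod z / (1 - a)"
  have b_root: "\<beta> ^ \<Delta> = b" "b powr (- 1 / real \<Delta>) = 1 / \<beta>" "x_fun \<Delta> b = (\<beta> - 1) / \<beta> ^ (\<Delta> - 1)"
    using root_facts[OF assms(3), of b] ab by (simp_all add: \<beta>_def)
  have beta: "1 < \<beta>"
    unfolding \<beta>_def using ab assms(3) by (intro gr_one_powr) auto
  have "0 < C_const \<Delta> g"
    unfolding C using pos by (rule positive_imp_inverse_positive)
  then have "0 < cmod q"
    using assms(6) by (rule less_le_trans)
  then have q: "q \<noteq> 0" by auto
  have "inverse (cmod q) \<le> inverse (C_const \<Delta> g)"
    using assms(6) \<open>0 < C_const \<Delta> g\<close> by (rule le_imp_inverse_le)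
  then have z_le: "cmod z \<le> (1 - a) * x_fun \<Delta> b"
    by (simp add: z_def C norm_divide inverse_eq_divide)
  then have x_le_fun: "x \<le> x_fun \<Delta> b" and x_nonneg: "0 \<le> x"
    using ab by (auto simp: x_def field_simps)
  have no_loop: "{v} \<notin> E" for v
    using assms(1) by (auto simp: finite_simple_graph_def)
  interpret partition_function E \<Delta> x \<beta> z a
  proof
    show "x * \<beta> ^ (\<Delta> - 1) \<le> \<beta> - 1"
      using x_le_fun beta unfolding b_root(3) by (simp add: pos_le_divide_eq)
    show "(real \<Delta> - 1) * (1 - 1 / \<beta>) < 1"
      using denom_pos_iff[OF assms(3), of b] ab
      unfolding denom_def[OF assms(3)] b_root(2) by simp
    show "x * (1 - a) = cmod z"
      using ab by (simp add: x_def)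
  qed (use no_loop finite_neighbors[OF assms(1,2)] card_neighbors_le[OF assms(1,2)] assms(3)
      x_nonneg beta ab q in \<open>auto simp: z_def\<close>)
  have f: "path_sum d = f_fun \<Delta> d b" for d
    unfolding path_sum_def f_fun_def b_root(2) ..
  have f_nonneg: "0 \<le> f_fun \<Delta> d b" for d
    using path_sum_nonneg[of d] by (simp add: f)
  \<comment> \<open>The bound is monotone in \<open>cmod z\<close> and in \<open>x\<close>, which
    are at most \<open>(1 - a) * x_fun \<Delta> b\<close> and
    \<open>x_fun \<Delta> b\<close>.\<close>
  have "vertex_bound g \<Delta> \<le> K_fun \<Delta> g a b"
    unfolding vertex_bound_def K_fun_def f b_root(1) using z_le x_le_fun x_nonneg ab f_nonneg
    by (intro add_mono diff_mono power_mono mult_mono mult_nonneg_nonneg) auto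
  then have "vertex_bound g \<Delta> \<le> a"
    using ab by simp
  moreover have "birooted Y n m \<le> x * \<beta> ^ \<Delta> * path_sum (g - 2)"
    if "finite Y" "u \<notin> Y" "m \<in> neighbors E u \<inter> Y" "n \<in> neighbors E u \<inter> Y" "m \<noteq> n" for Y u m n
  proof (rule birooted_le)
    show "card (neighbors E n \<inter> Y) \<le> \<Delta> - 1"
      using that by (intro card_neighbors_Int_less[of n u]) auto
    fix p assume "path_between E Y n m p"
    then have "is_cycle E (u # p)"
      using that by (intro cycle_from_path[of E Y n m]) (auto simp: neighbors_def insert_commute)
    \<comment> \<open>The cycle has \<open>length p + 1 \<ge> g\<close> vertices.\<close>
    from girth_le_length[OF this] show "g - 2 < length p"
      using assms(4,5) by simp
  qed (use that assms(5) in auto)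
  moreover have "finite V"
    using assms(1) by (simp add: finite_simple_graph_def)
  ultimately have "Z V \<noteq> 0"
    using Z_ratio by blast
  moreover have "poly (chromatic_poly V E) q = q ^ card V * Z V"
    unfolding Z_def \<phi>_def[abs_def] unfolding z_def
    by (rule poly_chromatic_poly_tree_weight[OF assms(1) q])
  ultimately show ?thesis
    using q by simp
qed

end
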